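(* Let $G$ be a finite graph with vertex set $V$, $n=|V|$, and let $f:\mathbb{R}\to\mathbb{R}$ be a non-constant odd real-analytic function. Let $x\in\mathbb{R}^V$ be an equilibrium of $\dot x_i=\sum_{j\in N(i)}f(x_j-x_i)$ ($i\in V$) and let $d\geq0$. Suppose that (i) there is an open neighborhood $U$ of $x$ in $\mathbb{R}^V$ such that $U$ intersects the set of equilibria in a manifold of dimension $d$; (ii) the Hessian matrix $D^2\mathcal{E}(x)$ has rank $n-d$. Then the equilibrium $x$ is Lyapunov stable if and only if the matrix $D^2\mathcal{E}(x)$ is positive semidefinite. Moreover, if the equilibrium $x$ is Lyapunov stable, then it is contained in a $d$-dimensional manifold of Lyapunov stable equilibria.
   Context: $G$ is a finite simple undirected graph; $N(i)$ is the set of neighbors of $i$. Fix an arbitrary orientation of each edge and let $E\subseteq V\times V$ be the set of oriented edges. The energy function is $\mathcal{E}:\mathbb{R}^V\to\mathbb{R}$, $\mathcal{E}(x)=\sum_{(j,k)\in E}g(x_k-x_j)$, where $g$ is any primitive of $f$; the system $\dot x_i=\sum_{j\in N(i)}f(x_j-x_i)$ equals $\dot x=-\nabla\mathcal{E}(x)$. "The set of equilibria" here is the set of all equilibria of this system in $\mathbb{R}^V$ (not modulo translations). An equilibrium $x$ is Lyapunov stable if every neighborhood of $x$ contains a forward-invariant neighborhood of $x$. *)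

theory Defs
  imports "HOL-Analysis.Analysis"
begin

definition real_analytic :: "(real \<Rightarrow> real) \<Rightarrow> bool" where
  "real_analytic f \<longleftrightarrow> (\<forall>a. \<exists>F. (\<lambda>u. f (a + u)) has_fps_expansion F)"

definition odd_function :: "(real \<Rightarrow> real) \<Rightarrow> bool" where
  "odd_function f \<longleftrightarrow> (\<forall>u. f (- u) = - f u)"


section \<open>The system on a graph and its energy\<close>

text \<open>
  The vertex set of the graph is the finite index type; the edges are given by an
  adjacency relation.
\<close>

definition simple_graph :: "('n \<Rightarrow> 'n \<Rightarrow> bool) \<Rightarrow> bool" where
  "simple_graph adj \<longleftrightarrow> symp adj \<and> irreflp adj"

definition orientation :: "('n \<Rightarrow> 'n \<Rightarrow> bool) \<Rightarrow> ('n \<times> 'n) set \<Rightarrow> bool" where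
  "orientation adj E \<longleftrightarrow>
     (\<forall>(j, k) \<in> E. adj j k) \<and>
     (\<forall>j k. adj j k \<longrightarrow> ((j, k) \<in> E) \<noteq> ((k, j) \<in> E))"

definition coupled_field ::
  "('n::finite \<Rightarrow> 'n \<Rightarrow> bool) \<Rightarrow> (real \<Rightarrow> real) \<Rightarrow> real^'n \<Rightarrow> real^'n" where
  "coupled_field adj f x = (\<chi> i. \<Sum>j | adj i j. f (x $ j - x $ i))"

definition equilibria :: "('a::real_normed_vector \<Rightarrow> 'a) \<Rightarrow> 'a set" where
  "equilibria F = {x. F x = 0}"

definition energy ::
  "('n::finite \<times> 'n) set \<Rightarrow> (real \<Rightarrow> real) \<Rightarrow> real^'n \<Rightarrow> real" where
  "energy E g x = (\<Sum>(j, k) \<in> E. g (x $ k - x $ j))"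


section \<open>Hessian matrix\<close>

definition partial_derivative :: "'n::finite \<Rightarrow> (real^'n \<Rightarrow> real) \<Rightarrow> real^'n \<Rightarrow> real" where
  "partial_derivative i h x = deriv (\<lambda>t. h (x + t *\<^sub>R axis i 1)) 0"

definition hessian :: "(real^'n::finite \<Rightarrow> real) \<Rightarrow> real^'n \<Rightarrow> real^'n^'n" where
  "hessian h x = (\<chi> i j. partial_derivative i (partial_derivative j h) x)"

definition positive_semidefinite :: "real^'n^'n::finite \<Rightarrow> bool" where
  "positive_semidefinite A \<longleftrightarrow> transpose A = A \<and> (\<forall>v. 0 \<le> v \<bullet> (A *v v))"


section \<open>Lyapunov stability\<close>

definition solution_on ::
  "('a::real_normed_vector \<Rightarrow> 'a) \<Rightarrow> real set \<Rightarrow> (real \<Rightarrow> 'a) \<Rightarrow> bool" where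
  "solution_on F I \<gamma> \<longleftrightarrow> (\<forall>t \<in> I. (\<gamma> has_vector_derivative F (\<gamma> t)) (at t within I))"

text \<open>
  Solutions may blow up in finite time, so invariance is required along every solution
  for as long as it exists, that is, on every compact interval \<open>{0..T}\<close> on which it is
  defined.
\<close>

definition forward_invariant :: "('a::real_normed_vector \<Rightarrow> 'a) \<Rightarrow> 'a set \<Rightarrow> bool" where
  "forward_invariant F S \<longleftrightarrow>
     (\<forall>\<gamma>. \<forall>T \<ge> 0. solution_on F {0..T} \<gamma> \<and> \<gamma> 0 \<in> S \<longrightarrow> (\<forall>t \<in> {0..T}. \<gamma> t \<in> S))"

definition lyapunov_stable :: "('a::real_normed_vector \<Rightarrow> 'a) \<Rightarrow> 'a \<Rightarrow> bool" where
  "lyapunov_stable F x \<longleftrightarrow>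
     (\<forall>W. x \<in> interior W \<longrightarrow> (\<exists>S \<subseteq> W. x \<in> interior S \<and> forward_invariant F S))"


section \<open>Smooth submanifolds of a Euclidean space\<close>

text \<open>
  Membership in \<open>C\<^sup>k\<close> on an open set: all iterated directional derivatives up to
  order \<open>k\<close> exist and are continuous.
\<close>

fun higher_differentiable_on ::
  "'a::euclidean_space set \<Rightarrow> ('a \<Rightarrow> 'b::euclidean_space) \<Rightarrow> nat \<Rightarrow> bool" where
  "higher_differentiable_on S h 0 \<longleftrightarrow> continuous_on S h"
| "higher_differentiable_on S h (Suc k) \<longleftrightarrow>
     (\<forall>y \<in> S. h differentiable (at y)) \<and>
     (\<forall>v. higher_differentiable_on S (\<lambda>y. frechet_derivative h (at y) v) k)"

definition smooth_on ::
  "'a::euclidean_space set \<Rightarrow> ('a \<Rightarrow> 'b::euclidean_space) \<Rightarrow> bool" where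
  "smooth_on S h \<longleftrightarrow> (\<forall>k. higher_differentiable_on S h k)"

text \<open>
  Embedded submanifolds without boundary, by slice charts: around each point, a
  diffeomorphism between open sets of the ambient space flattens \<open>M\<close> to a
  \<open>d\<close>-dimensional linear subspace.
\<close>

definition submanifold :: "nat \<Rightarrow> 'a::euclidean_space set \<Rightarrow> bool" where
  "submanifold d M \<longleftrightarrow>
     (\<forall>p \<in> M. \<exists>W \<Omega> L \<phi> \<psi>.
        open W \<and> p \<in> W \<and> open \<Omega> \<and> subspace L \<and> dim L = d \<and>
        homeomorphism W \<Omega> \<phi> \<psi> \<and> smooth_on W \<phi> \<and> smooth_on \<Omega> \<psi> \<and>
        \<phi> ` (W \<inter> M) = \<Omega> \<inter> (L :: 'a set))"

end

theory Submission
  imports Defs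
begin

text \<open>
  Write \<open>F = - \<nabla>E\<close> for the field. The rank condition says that the kernel of the Hessian at \<open>x\<close> is
  exactly the tangent space of the manifold of equilibria, so that \<open>E\<close> is a Morse--Bott function
  near \<open>x\<close>. Each \<open>y\<close> near \<open>x\<close> is compared with the equilibrium \<open>p\<close> obtained by projecting in a slice
  chart: \<open>norm (F y) \<ge> c * norm (y - p)\<close>, while \<open>E\<close> is constant on the equilibria and
  \<open>E y - E p\<close> is quadratic in \<open>y - p\<close>. This gives the Lojasiewicz inequality
  \<open>c * \<bar>E y - E x\<bar> \<le> (norm (F y))\<^sup>2\<close> near \<open>x\<close>. If the Hessian is positive semidefinite, the same
  comparison shows that \<open>x\<close> is a local minimum of \<open>E\<close>; the Lojasiewicz inequality then bounds the
  length of trajectories by the square root of their initial energy, which yields stability of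
  \<open>x\<close> and of all nearby equilibria. If \<open>x\<close> is stable, it must be a local minimum of \<open>E\<close>: otherwise a
  trajectory that starts nearby with \<open>E < E x\<close> loses energy at a rate bounded below forever.
\<close>

section \<open>Manifold charts and local Lipschitz solutions\<close>

text \<open>Mean value inequality for \<open>h\<close> minus its linearization at \<open>a\<close>:
  near \<open>a\<close> the derivative of this difference has operator norm at most
  \<open>e\<close>. Both points vary, so the estimate can compare two points neither of which is
  \<open>a\<close>.\<close>

lemma continuous_derivative_imp_strict:
  fixes h :: "'a::euclidean_space \<Rightarrow> 'b::real_normed_vector"
  assumes S: "open S" "a \<in> S"
    and deriv: "\<And>y. y \<in> S \<Longrightarrow> (h has_derivative h' y) (at y)"
    and cont: "\<And>v. continuous_on S (\<lambda>y. h' y v)"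
    and e: "0 < e"
  obtains \<delta> where "0 < \<delta>" "ball a \<delta> \<subseteq> S"
    "\<And>u w. u \<in> ball a \<delta> \<Longrightarrow> w \<in> ball a \<delta> \<Longrightarrow>
       norm (h u - h w - h' a (u - w)) \<le> e * norm (u - w)"
proof -
  \<comment> \<open>In finite dimension the operator norm is at most the sum of the norms on basis
    vectors, which turns continuity in each fixed direction into continuity in operator
    norm.\<close>
  have "((\<lambda>y. \<Sum>i\<in>Basis. norm (h' y i - h' a i)) \<longlongrightarrow> (\<Sum>i\<in>Basis. norm (h' a i - h' a i))) (at a)"
    using cont S by (intro tendsto_intros) (auto simp: continuous_on_eq_continuous_at isCont_def)
  then have "\<forall>\<^sub>F y in at a. (\<Sum>i\<in>Basis. norm (h' y i - h' a i)) < e"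
    using e by (auto dest: order_tendstoD(2))
  then obtain d1 where d1: "d1 > 0"
    "\<And>y. dist y a < d1 \<Longrightarrow> y \<noteq> a \<Longrightarrow> (\<Sum>i\<in>Basis. norm (h' y i - h' a i)) < e"
    unfolding eventually_at by auto
  obtain d2 where d2: "d2 > 0" "ball a d2 \<subseteq> S"
    using S open_contains_ball by blast
  define \<delta> where "\<delta> = min d1 d2"
  have sub: "ball a \<delta> \<subseteq> S"
    using d2 by (auto simp: \<delta>_def)
  have "norm (h u - h w - h' a (u - w)) \<le> e * norm (u - w)"
    if uw: "u \<in> ball a \<delta>" "w \<in> ball a \<delta>" for u w
  proof -
    have "norm (h u - h w - h' a (u - w)) \<le> norm (u - w) * e"
    proof (rule differentiable_bound_linearization[where S = "ball a \<delta>"])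
      show "w + t *\<^sub>R (u - w) \<in> ball a \<delta>" if "t \<in> {0..1}" for t
      proof -
        have "w + t *\<^sub>R (u - w) = (1 - t) *\<^sub>R w + t *\<^sub>R u"
          by (simp add: algebra_simps)
        then show ?thesis
          using convexD_alt[OF convex_ball uw(2,1), of t] that by simp
      qed
      show "(h has_derivative h' y) (at y within ball a \<delta>)" if "y \<in> ball a \<delta>" for y
        using deriv sub that has_derivative_at_withinI by blast
      show "a \<in> ball a \<delta>"
        using d1 d2 by (simp add: \<delta>_def)
      show "onorm (h' y - h' a) \<le> e" if y: "y \<in> ball a \<delta>" for y
      proof -
        have "bounded_linear (\<lambda>v. h' y v - h' a v)"
          using has_derivative_bounded_linear[OF deriv] sub y S by (intro bounded_linear_sub) auto
        then have "onorm (\<lambda>v. h' y v - h' a v) \<le> (\<Sum>i\<in>Basis. norm (h' y i - h' a i))"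
          by (rule onorm_componentwise)
        also have "\<dots> \<le> e"
          using d1(2)[of y] y e by (cases "y = a") (auto simp: \<delta>_def dist_commute)
        finally show ?thesis by (simp add: fun_diff_def)
      qed
    qed
    then show ?thesis by (simp add: mult.commute)
  qed
  then show thesis
    using that[of \<delta>] sub d1 d2 by (auto simp: \<delta>_def)
qed

section \<open>Smooth maps and slice charts\<close>

lemma higher_differentiable_on_subset:
  "higher_differentiable_on S h k \<Longrightarrow> T \<subseteq> S \<Longrightarrow> higher_differentiable_on T h k"
  by (induction k arbitrary: h) (auto intro: continuous_on_subset)

lemma smooth_on_subset: "smooth_on S h \<Longrightarrow> T \<subseteq> S \<Longrightarrow> smooth_on T h"
  unfolding smooth_on_def using higher_differentiable_on_subset by blast

lemma smooth_on_has_derivative: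
  assumes "smooth_on S h" "y \<in> S"
  shows "(h has_derivative frechet_derivative h (at y)) (at y)"
  using assms(1)[unfolded smooth_on_def, rule_format, of 1] assms(2) frechet_derivative_works by auto

lemma smooth_on_continuous_derivative:
  assumes "smooth_on S h"
  shows "continuous_on S (\<lambda>y. frechet_derivative h (at y) v)"
  using assms[unfolded smooth_on_def, rule_format, of 1] by auto

text \<open>Shrinking the chart domain to \<open>W \<inter> B\<close> shrinks its image to the part
  of \<Omega> that \<psi> sends into \<open>B\<close>; the slice \<open>L\<close> stays the
  same.\<close>

lemma submanifold_open_Int:
  fixes M :: "'a::euclidean_space set"
  assumes M: "submanifold d M" and B: "open B"
  shows "submanifold d (B \<inter> M)"
  unfolding submanifold_def
proof
  fix p assume p: "p \<in> B \<inter> M"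
  then obtain W \<Omega> and L :: "'a set" and \<phi> \<psi> where W: "open W" "p \<in> W" "open \<Omega>" "subspace L" "dim L = d"
    "homeomorphism W \<Omega> \<phi> \<psi>" "smooth_on W \<phi>" "smooth_on \<Omega> \<psi>" "\<phi> ` (W \<inter> M) = \<Omega> \<inter> L"
    using M unfolding submanifold_def by (metis IntD2)
  have eq: "\<phi> ` (W \<inter> B) = \<Omega> \<inter> \<psi> -` B"
    using homeomorphism_apply1[OF W(6)] homeomorphism_apply2[OF W(6)]
      homeomorphism_image1[OF W(6)] homeomorphism_image2[OF W(6)] by force
  have "open (\<Omega> \<inter> \<psi> -` B)"
    using homeomorphism_cont2[OF W(6)] W(3) B by (rule continuous_open_preimage)
  moreover have "homeomorphism (W \<inter> B) (\<Omega> \<inter> \<psi> -` B) \<phi> \<psi>"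
    using eq by (intro homeomorphism_of_subsets[OF W(6)]) auto
  moreover have "\<phi> ` ((W \<inter> B) \<inter> (B \<inter> M)) = (\<Omega> \<inter> \<psi> -` B) \<inter> L"
  proof
    show "\<phi> ` ((W \<inter> B) \<inter> (B \<inter> M)) \<subseteq> (\<Omega> \<inter> \<psi> -` B) \<inter> L"
      using eq W(9) by blast
    show "(\<Omega> \<inter> \<psi> -` B) \<inter> L \<subseteq> \<phi> ` ((W \<inter> B) \<inter> (B \<inter> M))"
    proof
      fix z assume z: "z \<in> (\<Omega> \<inter> \<psi> -` B) \<inter> L"
      then have "z \<in> \<phi> ` (W \<inter> M)"
        using W(9) by auto
      then obtain w where "w \<in> W" "w \<in> M" "z = \<phi> w" by auto
      moreover from this have "w \<in> B"
        using z homeomorphism_apply1[OF W(6)] by auto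
      ultimately show "z \<in> \<phi> ` ((W \<inter> B) \<inter> (B \<inter> M))" by auto
    qed
  qed
  moreover have "smooth_on (W \<inter> B) \<phi>" "smooth_on (\<Omega> \<inter> \<psi> -` B) \<psi>"
    using W smooth_on_subset by (metis inf_le1)+
  moreover have "open (W \<inter> B)" "p \<in> W \<inter> B"
    using W B p by auto
  ultimately show "\<exists>W \<Omega> L \<phi> \<psi>. open W \<and> p \<in> W \<and> open \<Omega> \<and> subspace L \<and> dim L = d \<and>
        homeomorphism W \<Omega> \<phi> \<psi> \<and> smooth_on W \<phi> \<and> smooth_on \<Omega> \<psi> \<and>
        \<phi> ` (W \<inter> (B \<inter> M)) = \<Omega> \<inter> (L :: 'a set)"
    using W(4,5) by blast
qed

text \<open>The inverse chart \<psi>, restricted to \<open>L\<close>, parametrizes \<open>M\<close>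
  near \<open>x\<close>. Its derivative is injective by the chain rule, because \<phi> is a
  differentiable left inverse of \<psi>.\<close>

lemma submanifold_slice_chart:
  fixes M :: "'a::euclidean_space set"
  assumes "submanifold d M" "x \<in> M"
  obtains W \<Omega> L \<phi> \<psi> where "open W" "x \<in> W" "open \<Omega>" "subspace L" "dim (L :: 'a set) = d"
    "homeomorphism W \<Omega> \<phi> \<psi>" "smooth_on \<Omega> \<psi>" "\<phi> x \<in> L" "\<psi> ` (\<Omega> \<inter> L) \<subseteq> M"
    "(\<psi> has_derivative frechet_derivative \<psi> (at (\<phi> x))) (at (\<phi> x))"
    "inj (frechet_derivative \<psi> (at (\<phi> x)))"
proof -
  obtain W \<Omega> and L :: "'a set" and \<phi> \<psi> where W: "open W" "x \<in> W" "open \<Omega>" "subspace L" "dim L = d"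
    "homeomorphism W \<Omega> \<phi> \<psi>" "smooth_on W \<phi>" "smooth_on \<Omega> \<psi>" "\<phi> ` (W \<inter> M) = \<Omega> \<inter> L"
    using assms unfolding submanifold_def by metis
  define a where "a = \<phi> x"
  have a: "a \<in> \<Omega>" "a \<in> L" "\<psi> a = x"
    using W assms homeomorphism_apply1[OF W(6)] unfolding a_def by auto
  define D where "D = frechet_derivative \<psi> (at a)"
  have D: "(\<psi> has_derivative D) (at a)"
    unfolding D_def using W(8) a by (intro smooth_on_has_derivative)
  have "(\<phi> has_derivative frechet_derivative \<phi> (at (\<psi> a))) (at (\<psi> a))"
    using W(7) W(2) a by (intro smooth_on_has_derivative) auto
  from diff_chain_at[OF D this]
  have "((\<phi> \<circ> \<psi>) has_derivative (frechet_derivative \<phi> (at (\<psi> a)) \<circ> D)) (at a)" .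
  moreover have "((\<phi> \<circ> \<psi>) has_derivative id) (at a)"
    using homeomorphism_apply2[OF W(6)]
    by (intro has_derivative_transform_within_open[OF has_derivative_id W(3) a(1)]) auto
  ultimately have "frechet_derivative \<phi> (at (\<psi> a)) \<circ> D = id"
    by (rule has_derivative_unique)
  then have "inj D"
    by (metis inj_on_id inj_on_imageI2)
  moreover have "\<psi> ` (\<Omega> \<inter> L) \<subseteq> M"
  proof clarify
    fix q assume "q \<in> \<Omega>" "q \<in> L"
    then have "q \<in> \<phi> ` (W \<inter> M)"
      using W(9) by blast
    then show "\<psi> q \<in> M"
      using homeomorphism_apply1[OF W(6)] by auto
  qed
  ultimately show thesis
    using W(1-6,8) a(2) D unfolding a_def D_def by (intro that[of W \<Omega> L \<phi> \<psi>])
qed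

text \<open>Picard iteration on \<open>{0..\<tau>}\<close>, as a contraction of the bounded continuous functions on the
  whole line: the time variable is clamped to \<open>{0..\<tau>}\<close>.\<close>

lemma lipschitz_bounded_solution:
  fixes G :: "'a::euclidean_space \<Rightarrow> 'a"
  assumes lip: "\<And>u w. norm (G u - G w) \<le> L * norm (u - w)" and bound: "\<And>u. norm (G u) \<le> B"
    and L: "0 \<le> L" and \<tau>: "0 \<le> \<tau>" "L * \<tau> \<le> 1 / 2"
  obtains \<gamma> where "solution_on G {0..\<tau>} \<gamma>" "\<gamma> 0 = x0"
    "\<And>t. t \<in> {0..\<tau>} \<Longrightarrow> norm (\<gamma> t - x0) \<le> B * \<tau>"
proof -
  define cl where "cl t = max 0 (min \<tau> t)" for t :: real
  have cl: "0 \<le> cl t" "cl t \<le> \<tau>" "t \<in> {0..\<tau>} \<Longrightarrow> cl t = t" for t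
    using \<tau> by (auto simp: cl_def)
  have cl_cont: "continuous_on UNIV cl"
    unfolding cl_def by (intro continuous_intros)
  have G_cont: "continuous_on UNIV G"
  proof (rule lipschitz_on_continuous_on)
    show "L-lipschitz_on UNIV G"
      unfolding lipschitz_on_def dist_norm
      using lip L by blast
  qed
  have B: "0 \<le> B"
    using bound norm_ge_zero order_trans by blast
  have G\<gamma>: "continuous_on S (\<lambda>s. G (apply_bcontfun \<gamma> s))" for \<gamma> :: "real \<Rightarrow>\<^sub>C 'a" and S
    by (intro continuous_on_compose2[OF G_cont]) auto
  define P where "P \<gamma> t = x0 + integral {0..cl t} (\<lambda>s. G (apply_bcontfun \<gamma> s))" for \<gamma> :: "real \<Rightarrow>\<^sub>C 'a" and t
  have P_bound: "norm (P \<gamma> t - x0) \<le> B * \<tau>" for \<gamma> t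
  proof -
    have "norm (P \<gamma> t - x0) \<le> B * (cl t - 0)"
      unfolding P_def using cl[of t] bound G\<gamma> by (auto intro!: integral_bound[THEN order_trans])
    also have "\<dots> \<le> B * \<tau>"
      using B cl[of t] by (intro mult_left_mono) auto
    finally show ?thesis .
  qed
  have "P \<gamma> \<in> bcontfun" for \<gamma>
  proof -
    have "continuous_on {0..\<tau>} (\<lambda>u. integral {0..u} (\<lambda>s. G (apply_bcontfun \<gamma> s)))"
      by (intro indefinite_integral_continuous_1 integrable_continuous_real G\<gamma>)
    then have "continuous_on UNIV (\<lambda>t. integral {0..cl t} (\<lambda>s. G (apply_bcontfun \<gamma> s)))"
      by (rule continuous_on_compose2[OF _ cl_cont]) (use cl in auto)
    then have "continuous_on UNIV (P \<gamma>)"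
      unfolding P_def by (intro continuous_intros)
    moreover have "bounded (range (P \<gamma>))"
      using P_bound[of \<gamma>] unfolding bounded_def by (intro exI[of _ x0] exI[of _ "B * \<tau>"])
        (auto simp: dist_norm norm_minus_commute)
    ultimately show ?thesis
      by (simp add: bcontfun_def)
  qed
  then have P_apply: "apply_bcontfun (Bcontfun (P \<gamma>)) = P \<gamma>" for \<gamma>
    by (rule Bcontfun_inverse)
  have "dist (Bcontfun (P \<gamma>)) (Bcontfun (P \<eta>)) \<le> 1 / 2 * dist \<gamma> \<eta>" for \<gamma> \<eta>
  proof (rule dist_bound)
    fix t
    have lip_dist: "norm (G (apply_bcontfun \<gamma> s) - G (apply_bcontfun \<eta> s)) \<le> L * dist \<gamma> \<eta>" for s
    proof -
      have "norm (G (apply_bcontfun \<gamma> s) - G (apply_bcontfun \<eta> s)) \<le> L * dist (apply_bcontfun \<gamma> s) (apply_bcontfun \<eta> s)"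
        using lip by (simp add: dist_norm)
      also have "\<dots> \<le> L * dist \<gamma> \<eta>"
        using L by (intro mult_left_mono dist_bounded)
      finally show ?thesis .
    qed
    have "P \<gamma> t - P \<eta> t = integral {0..cl t} (\<lambda>s. G (apply_bcontfun \<gamma> s) - G (apply_bcontfun \<eta> s))"
      unfolding P_def by (simp add: integral_diff integrable_continuous_real G\<gamma>)
    also have "norm \<dots> \<le> L * dist \<gamma> \<eta> * (cl t - 0)"
      using cl[of t] by (intro integral_bound lip_dist continuous_on_diff G\<gamma>) auto
    also have "\<dots> \<le> L * dist \<gamma> \<eta> * \<tau>"
      using cl[of t] L by (intro mult_left_mono) auto
    also have "\<dots> = (L * \<tau>) * dist \<gamma> \<eta>"
      by simp
    also have "\<dots> \<le> 1 / 2 * dist \<gamma> \<eta>"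
      using \<tau> by (intro mult_right_mono) auto
    finally show "dist (apply_bcontfun (Bcontfun (P \<gamma>)) t) (apply_bcontfun (Bcontfun (P \<eta>)) t) \<le> 1 / 2 * dist \<gamma> \<eta>"
      by (simp add: P_apply dist_norm)
  qed
  then have "\<exists>!\<gamma>. Bcontfun (P \<gamma>) = \<gamma>"
    by (intro banach_fix_type[of "1 / 2"]) auto
  then obtain \<gamma> where \<gamma>: "Bcontfun (P \<gamma>) = \<gamma>"
    by blast
  then have fixpoint: "apply_bcontfun \<gamma> t = P \<gamma> t" for t
    using P_apply by metis
  show thesis
  proof (rule that[of "apply_bcontfun \<gamma>"])
    show "apply_bcontfun \<gamma> 0 = x0"
      using cl(3)[of 0] \<tau> by (subst fixpoint) (simp add: P_def)
    show "norm (apply_bcontfun \<gamma> t - x0) \<le> B * \<tau>" for t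
      using P_bound by (subst fixpoint)
    \<comment> \<open>On \<open>{0..\<tau>}\<close> the clamp is the identity, so the fixed point
      satisfies the integral equation there and can be differentiated.\<close>
    show "solution_on G {0..\<tau>} (apply_bcontfun \<gamma>)"
      unfolding solution_on_def
    proof
      fix t assume t: "t \<in> {0..\<tau>}"
      have int: "((\<lambda>u. x0 + integral {0..u} (\<lambda>s. G (apply_bcontfun \<gamma> s))) has_vector_derivative
          G (apply_bcontfun \<gamma> t)) (at t within {0..\<tau>})"
        using has_vector_derivative_add[OF has_vector_derivative_const
            integral_has_vector_derivative[OF G\<gamma> t]] by simp
      have eq: "apply_bcontfun \<gamma> u = x0 + integral {0..u} (\<lambda>s. G (apply_bcontfun \<gamma> s))"
        if "u \<in> {0..\<tau>}" for u
        using fixpoint[of u] cl(3)[OF that] by (simp only: P_def)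
      show "(apply_bcontfun \<gamma> has_vector_derivative G (apply_bcontfun \<gamma> t)) (at t within {0..\<tau>})"
        by (rule has_vector_derivative_transform[OF t eq int])
    qed
  qed
qed

section \<open>Gradient fields near a manifold of equilibria\<close>

text \<open>\<open>F\<close> is minus the gradient of \<open>E\<close>, and \<open>F' y\<close> is
  minus the Hessian of \<open>E\<close> at \<open>y\<close>, kept as a symmetric operator rather
  than a matrix.\<close>

locale gradient_system =
  fixes E :: "'a::euclidean_space \<Rightarrow> real" and F :: "'a \<Rightarrow> 'a" and F' :: "'a \<Rightarrow> 'a \<Rightarrow> 'a"
  assumes E_deriv: "(E has_derivative (\<lambda>h. - (F y \<bullet> h))) (at y)"
    and F_deriv: "(F has_derivative F' y) (at y)"
    and F'_cont: "continuous_on UNIV (\<lambda>y. F' y v)"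
    and F'_sym: "F' y u \<bullet> v = u \<bullet> F' y v"
begin

lemma F'_bounded_linear: "bounded_linear (F' y)"
  using F_deriv by (rule has_derivative_bounded_linear)

lemma F'_linear: "linear (F' y)"
  using F'_bounded_linear by (rule bounded_linear.linear)

lemma F_continuous_on: "continuous_on S F"
  using F_deriv has_derivative_continuous continuous_at_imp_continuous_on by blast

lemma E_continuous_on: "continuous_on S E"
  using E_deriv has_derivative_continuous continuous_at_imp_continuous_on by blast

lemma F_strict:
  assumes "0 < e"
  obtains \<delta> where "0 < \<delta>"
    "\<And>u w. u \<in> ball x \<delta> \<Longrightarrow> w \<in> ball x \<delta> \<Longrightarrow> norm (F u - F w - F' x (u - w)) \<le> e * norm (u - w)"
  using continuous_derivative_imp_strict[of UNIV x F F' e] F_deriv F'_cont assms by auto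

text \<open>The linear and quadratic models are taken at \<open>x\<close>, whereas the base point
  \<open>p\<close> is any nearby equilibrium. The energy estimate follows from the field estimate by
  the mean value inequality along the segment from \<open>p\<close> to \<open>z\<close>.\<close>

lemma energy_expansion:
  assumes "0 < e"
  obtains \<delta> where "0 < \<delta>"
    "\<And>p z. p \<in> ball x \<delta> \<Longrightarrow> z \<in> ball x \<delta> \<Longrightarrow> F p = 0 \<Longrightarrow>
       norm (F z - F' x (z - p)) \<le> e * norm (z - p) \<and>
       \<bar>E z - E p + ((z - p) \<bullet> F' x (z - p)) / 2\<bar> \<le> e * (norm (z - p))\<^sup>2"
proof -
  obtain \<delta> where \<delta>: "0 < \<delta>"
    "\<And>u w. u \<in> ball x \<delta> \<Longrightarrow> w \<in> ball x \<delta> \<Longrightarrow> norm (F u - F w - F' x (u - w)) \<le> e * norm (u - w)"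
    using F_strict[OF assms] by blast
  interpret A: bounded_linear "F' x" by (rule F'_bounded_linear)
  have "\<bar>E z - E p + ((z - p) \<bullet> F' x (z - p)) / 2\<bar> \<le> e * (norm (z - p))\<^sup>2"
    if p: "p \<in> ball x \<delta>" and z: "z \<in> ball x \<delta>" and Fp: "F p = 0" for p z
  proof -
    \<comment> \<open>Up to the constant \<open>E p\<close>, this is the error of the quadratic
      model. Symmetry of \<open>F' x\<close> makes its gradient
      \<open>- (F u - F' x (u - p))\<close>, which the strict estimate bounds.\<close>
    define R where "R u = E u + 1 / 2 * ((u - p) \<bullet> F' x (u - p))" for u
    have R: "(R has_derivative (\<lambda>h. - ((F u - F' x (u - p)) \<bullet> h))) (at u within T)" for u T
    proof -
      have sym: "h \<bullet> F' x (u - p) = u \<bullet> F' x h - p \<bullet> F' x h"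
        "F' x (u - p) \<bullet> h = u \<bullet> F' x h - p \<bullet> F' x h" for h
        by (metis F'_sym inner_commute inner_diff_left)+
      have d: "((\<lambda>u. u - p) has_derivative (\<lambda>h. h)) (at u within T)"
        by (auto intro!: derivative_eq_intros)
      show ?thesis
        unfolding R_def
        by (rule has_derivative_eq_rhs[OF has_derivative_add[OF has_derivative_at_withinI[OF E_deriv]
              has_derivative_mult_right[OF has_derivative_inner[OF d A.has_derivative[OF d]]]]])
          (simp add: fun_eq_iff inner_diff_left sym)
    qed
    have sub: "closed_segment p z \<subseteq> ball x \<delta>"
      using p z by (intro closed_segment_subset) auto
    have "norm (R z - R p) \<le> (e * norm (z - p)) * norm (z - p)"
    proof (rule differentiable_bound[OF convex_closed_segment R])
      fix u assume u: "u \<in> closed_segment p z"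
      have "norm (F u - F' x (u - p)) \<le> e * norm (u - p)"
        using \<delta>(2)[of u p] u sub p Fp by auto
      also have "\<dots> \<le> e * norm (z - p)"
        using segment_bound(1)[OF u] assms by (simp add: norm_minus_commute)
      finally have *: "norm (F u - F' x (u - p)) \<le> e * norm (z - p)" .
      show "onorm (\<lambda>h. - ((F u - F' x (u - p)) \<bullet> h)) \<le> e * norm (z - p)"
      proof (rule onorm_bound)
        fix h
        have "norm (- ((F u - F' x (u - p)) \<bullet> h)) \<le> norm (F u - F' x (u - p)) * norm h"
          using Cauchy_Schwarz_ineq2 by simp
        also have "\<dots> \<le> e * norm (z - p) * norm h"
          using * by (intro mult_right_mono) auto
        finally show "norm (- ((F u - F' x (u - p)) \<bullet> h)) \<le> e * norm (z - p) * norm h" .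
      qed (use assms in auto)
    qed auto
    moreover have "R z - R p = E z - E p + ((z - p) \<bullet> F' x (z - p)) / 2"
      by (simp add: R_def A.zero)
    ultimately show ?thesis
      by (simp add: power2_eq_square mult.assoc)
  qed
  moreover have "norm (F z - F' x (z - p)) \<le> e * norm (z - p)"
    if "p \<in> ball x \<delta>" "z \<in> ball x \<delta>" "F p = 0" for p z
    using \<delta>(2)[of z p] that by simp
  ultimately show thesis
    using that \<delta>(1) by blast
qed

section \<open>The Lojasiewicz inequality near the manifold of equilibria\<close>

text \<open>The map \<open>y \<mapsto> p\<close> projects to \<open>L\<close> in the slice chart. By the rank condition, the kernel of
  \<open>F' x\<close> is exactly the tangent space \<open>D ` L\<close>, so \<open>F' x \<circ> D\<close> is injective on the orthogonal
  complement of \<open>L\<close>.\<close>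

lemma norm_field_ge_distance_equilibrium:
  assumes x: "x \<in> U" "F x = 0"
    and M: "submanifold d (U \<inter> equilibria F)"
    and ker: "dim {v. F' x v = 0} = d"
  obtains c where "0 < c"
    "\<And>r. 0 < r \<Longrightarrow> \<exists>\<delta>>0. \<forall>y \<in> ball x \<delta>. \<exists>p \<in> ball x r.
       F p = 0 \<and> E p = E x \<and> c * norm (y - p) \<le> norm (F y)"
proof -
  have "x \<in> U \<inter> equilibria F"
    using x by (simp add: equilibria_def)
  then obtain W \<Omega> and L :: "'a set" and \<phi> \<psi> where W: "open W" "x \<in> W" "open \<Omega>" "subspace L" "dim L = d"
    "homeomorphism W \<Omega> \<phi> \<psi>" "smooth_on \<Omega> \<psi>" "\<phi> x \<in> L" "\<psi> ` (\<Omega> \<inter> L) \<subseteq> U \<inter> equilibria F"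
    "(\<psi> has_derivative frechet_derivative \<psi> (at (\<phi> x))) (at (\<phi> x))"
    "inj (frechet_derivative \<psi> (at (\<phi> x)))"
    by (rule submanifold_slice_chart[OF M])
  define a where "a = \<phi> x"
  define D where "D = frechet_derivative \<psi> (at a)"
  have a: "a \<in> \<Omega>" "a \<in> L" "\<psi> a = x"
    using W homeomorphism_apply1[OF W(6)] homeomorphism_image1[OF W(6)] unfolding a_def by auto
  have F\<psi>: "F (\<psi> q) = 0" if "q \<in> \<Omega>" "q \<in> L" for q
    using W(9) that by (auto simp: equilibria_def)
  have D: "(\<psi> has_derivative D) (at a)" "inj D"
    using W(10,11) by (auto simp: D_def a_def)
  interpret D: bounded_linear D
    using D(1) by (rule has_derivative_bounded_linear)
  interpret A: bounded_linear "F' x" by (rule F'_bounded_linear)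
  \<comment> \<open>For small \<open>t\<close> the curve \<open>\<psi> (a + t *\<^sub>R v)\<close>
    consists of equilibria; differentiating \<open>F\<close> along it at 0 gives
    \<open>F' x (D v) = 0\<close>.\<close>
  have tangent: "D ` L \<subseteq> {v. F' x v = 0}"
  proof clarify
    fix v assume v: "v \<in> L"
    have line: "((\<lambda>t::real. a + t *\<^sub>R v) has_derivative (\<lambda>t. t *\<^sub>R v)) (at 0)"
      by (auto intro!: derivative_eq_intros)
    have "((F \<circ> \<psi>) has_derivative F' x \<circ> D) (at (a + 0 *\<^sub>R v))"
      using D(1) a F_deriv[of x] by (intro diff_chain_at) auto
    from diff_chain_at[OF line this]
    have 1: "(((F \<circ> \<psi>) \<circ> (\<lambda>t. a + t *\<^sub>R v)) has_derivative (F' x \<circ> D) \<circ> (\<lambda>t. t *\<^sub>R v)) (at 0)" .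
    have "open ((\<lambda>t::real. a + t *\<^sub>R v) -` \<Omega>)"
      by (intro open_vimage W(3) continuous_intros)
    then have "(((F \<circ> \<psi>) \<circ> (\<lambda>t. a + t *\<^sub>R v)) has_derivative (\<lambda>t. 0)) (at 0)"
      by (rule has_derivative_transform_within_open[OF has_derivative_const])
        (use F\<psi> a v W(4) in \<open>auto simp: subspace_add subspace_scale\<close>)
    from fun_cong[OF has_derivative_unique[OF 1 this], of 1] show "F' x (D v) = 0"
      by simp
  qed
  \<comment> \<open>Injectivity of \<open>D\<close> gives the tangent space the dimension of the
    kernel, so the inclusion becomes an equality.\<close>
  have "dim (D ` L) = d"
    using dim_image_eq[OF D.linear_axioms, of L] D(2) W(5) by (auto intro: inj_on_subset)
  then have ker_eq: "D ` L = {v. F' x v = 0}"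
    using ker W(4) tangent
    by (intro subspace_dim_equal linear_subspace_image D.linear_axioms linear_subspace_kernel
        A.linear_axioms) auto
  define N where "N = orthogonal_comp L"
  have "\<exists>c>0. \<forall>w\<in>N. norm ((F' x \<circ> D) w) \<ge> c * norm w"
  proof (rule injective_imp_isometric)
    show "subspace N" "closed N"
      unfolding N_def by (auto simp: subspace_orthogonal_comp closed_subspace)
    show "bounded_linear (F' x \<circ> D)"
      unfolding o_def using A.bounded_linear_axioms D.bounded_linear_axioms
      by (rule bounded_linear_compose)
    show "\<forall>w\<in>N. (F' x \<circ> D) w = 0 \<longrightarrow> w = 0"
    proof clarify
      fix w assume w: "w \<in> N" "(F' x \<circ> D) w = 0"
      then have "D w \<in> D ` L"
        by (simp add: ker_eq)
      then have "w \<in> L"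
        using D(2) by (simp add: inj_image_mem_iff)
      then show "w = 0"
        using w(1) by (auto simp: N_def orthogonal_comp_def orthogonal_def)
    qed
  qed
  then obtain c1 where c1: "c1 > 0" "\<And>w. w \<in> N \<Longrightarrow> c1 * norm w \<le> norm (F' x (D w))"
    by auto
  obtain KA where KA: "KA > 0" "\<And>v. norm (F' x v) \<le> norm v * KA"
    using A.pos_bounded by blast
  obtain KD where KD: "KD > 0" "\<And>v. norm (D v) \<le> norm v * KD"
    using D.pos_bounded by blast
  \<comment> \<open>Small enough that the total error \<open>e * (KA + KD + 1) * norm w\<close>
    below costs at most half of the lower bound \<open>c1 * norm w\<close>.\<close>
  define e where "e = min 1 (c1 / (2 * (KA + KD + 1)))"
  have e: "0 < e" "e \<le> 1"
    using c1 KA KD by (auto simp: e_def)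
  have "e * (KA + KD + 1) \<le> c1 / (2 * (KA + KD + 1)) * (KA + KD + 1)"
    using KA KD by (intro mult_right_mono) (auto simp: e_def)
  also have "\<dots> = c1 / 2"
    using KA KD by (simp add: field_simps)
  finally have e2: "e * (KA + KD + 1) \<le> c1 / 2" .
  obtain \<delta>1 where \<delta>1: "0 < \<delta>1"
    "\<And>u w. u \<in> ball x \<delta>1 \<Longrightarrow> w \<in> ball x \<delta>1 \<Longrightarrow> norm (F u - F w - F' x (u - w)) \<le> e * norm (u - w)"
    using F_strict[OF e(1)] by blast
  obtain \<delta>2 where \<delta>2: "0 < \<delta>2" "ball a \<delta>2 \<subseteq> \<Omega>"
    "\<And>u w. u \<in> ball a \<delta>2 \<Longrightarrow> w \<in> ball a \<delta>2 \<Longrightarrow> norm (\<psi> u - \<psi> w - D (u - w)) \<le> e * norm (u - w)"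
    unfolding D_def
    using continuous_derivative_imp_strict[OF W(3) a(1) smooth_on_has_derivative[OF W(7)]
        smooth_on_continuous_derivative[OF W(7)] e(1)] by blast
  \<comment> \<open>Half of \<open>c1\<close> remains after the error is absorbed, and
    \<open>KD + 1\<close> converts \<open>norm w\<close> into \<open>norm (y - p)\<close>. Nothing
    here depends on \<open>r\<close>, so \<open>c\<close> can be fixed before
    \<open>r\<close>.\<close>
  define c where "c = c1 / (2 * (KD + 1))"
  have "\<exists>\<delta>>0. \<forall>y \<in> ball x \<delta>. \<exists>p \<in> ball x r. F p = 0 \<and> E p = E x \<and> c * norm (y - p) \<le> norm (F y)"
    if r: "0 < r" for r
  proof -
    have "open (\<Omega> \<inter> \<psi> -` ball x (min \<delta>1 r))"
      using homeomorphism_cont2[OF W(6)] W(3) by (intro continuous_open_preimage) auto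
    moreover have "a \<in> \<Omega> \<inter> \<psi> -` ball x (min \<delta>1 r)"
      using a \<delta>1 r by auto
    ultimately obtain \<delta>3' where \<delta>3': "0 < \<delta>3'" "ball a \<delta>3' \<subseteq> \<Omega> \<inter> \<psi> -` ball x (min \<delta>1 r)"
      using open_contains_ball by blast
    define \<delta>3 where "\<delta>3 = min \<delta>2 \<delta>3'"
    have \<delta>3: "0 < \<delta>3" "ball a \<delta>3 \<subseteq> \<Omega>" "ball a \<delta>3 \<subseteq> ball a \<delta>2"
      "\<And>q. q \<in> ball a \<delta>3 \<Longrightarrow> \<psi> q \<in> ball x \<delta>1 \<and> \<psi> q \<in> ball x r"
      using \<delta>2(1) \<delta>3' by (auto simp: \<delta>3_def)
    have "open (W \<inter> \<phi> -` ball a \<delta>3)"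
      using homeomorphism_cont1[OF W(6)] W(1) by (intro continuous_open_preimage) auto
    moreover have "x \<in> W \<inter> \<phi> -` ball a \<delta>3"
      using W(2) \<delta>3(1) by (simp add: a_def)
    ultimately obtain \<delta> where \<delta>: "0 < \<delta>" "ball x \<delta> \<subseteq> W \<inter> \<phi> -` ball a \<delta>3"
      using open_contains_ball by blast
    \<comment> \<open>The slice is convex and \<psi> maps it to zeros of \<open>F\<close>, so the
      derivative of \<open>E \<circ> \<psi>\<close> vanishes along it.\<close>
    have E\<psi>: "E (\<psi> q) = E x" if q: "q \<in> L" "q \<in> ball a \<delta>3" for q
    proof -
      have "\<exists>c. \<forall>u \<in> L \<inter> ball a \<delta>3. (E \<circ> \<psi>) u = c"
      proof (rule has_derivative_zero_constant)
        show "convex (L \<inter> ball a \<delta>3)"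
          using W(4) by (intro convex_Int convex_ball subspace_imp_convex)
        fix u assume u: "u \<in> L \<inter> ball a \<delta>3"
        then have "u \<in> \<Omega>" "F (\<psi> u) = 0"
          using \<delta>3(2) F\<psi> by auto
        then have "((E \<circ> \<psi>) has_derivative (\<lambda>h. 0)) (at u)"
          using diff_chain_at[OF smooth_on_has_derivative[OF W(7)] E_deriv[of "\<psi> u"]]
          by (simp add: o_def)
        then show "((E \<circ> \<psi>) has_derivative (\<lambda>h. 0)) (at u within L \<inter> ball a \<delta>3)"
          by (rule has_derivative_at_withinI)
      qed
      then show ?thesis
        using q a \<delta>3(1) by (metis IntI centre_in_ball comp_apply)
    qed
    have "\<exists>p \<in> ball x r. F p = 0 \<and> E p = E x \<and> c * norm (y - p) \<le> norm (F y)"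
      if y: "y \<in> ball x \<delta>" for y
    proof -
      have \<phi>y: "y \<in> W" "\<phi> y \<in> ball a \<delta>3" "\<psi> (\<phi> y) = y"
        using \<delta>(2) y homeomorphism_apply1[OF W(6)] by auto
      \<comment> \<open>In chart coordinates, the component \<open>l\<close> along the slice yields
        the equilibrium \<open>p = \<psi> (a + l)\<close>, while \<open>w\<close> measures the
        displacement from it.\<close>
      obtain l w where l: "l \<in> span L" and w: "\<And>v. v \<in> span L \<Longrightarrow> orthogonal w v" and eq: "\<phi> y - a = l + w"
        using orthogonal_subspace_decomp_exists[of L "\<phi> y - a"] by blast
      have lw: "l \<in> L" "w \<in> N" "\<phi> y - a = l + w"
        using l w eq span_eq_iff[THEN iffD2, OF W(4)]
        by (auto simp: N_def orthogonal_comp_def orthogonal_commute)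
      \<comment> \<open>Pythagoras keeps \<open>a + l\<close> in the same ball as
        \<open>\<phi> y\<close>.\<close>
      have "(norm (\<phi> y - a))\<^sup>2 = (norm l)\<^sup>2 + (norm w)\<^sup>2"
        unfolding lw(3) using lw(1,2) by (intro norm_add_Pythagorean) (auto simp: N_def orthogonal_comp_def)
      then have "norm l \<le> norm (\<phi> y - a)"
        by (metis le_add_same_cancel1 norm_ge_zero power2_le_imp_le zero_le_power2)
      then have q: "a + l \<in> ball a \<delta>3" "a + l \<in> L"
        using \<phi>y(2) a(2) lw(1) W(4) by (auto simp: dist_norm norm_minus_commute subspace_add)
      define p where "p = \<psi> (a + l)"
      define v where "v = y - p"
      have p: "p \<in> ball x r" "p \<in> ball x \<delta>1" "F p = 0" "E p = E x"
        using \<delta>3 q F\<psi> E\<psi> by (auto simp: p_def)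
      have "y \<in> ball x \<delta>1"
        using \<delta>3(4)[OF \<phi>y(2)] \<phi>y(3) by simp
      then have Fy: "norm (F y - F' x v) \<le> e * norm v"
        using \<delta>1(2)[of y p] p by (simp add: v_def)
      have w: "\<phi> y - (a + l) = w"
        using lw(3) by (simp add: algebra_simps)
      have vw: "norm (v - D w) \<le> e * norm w"
        using \<delta>2(3)[of "\<phi> y" "a + l"] subsetD[OF \<delta>3(3)] \<phi>y q unfolding v_def p_def w by metis
      have "norm v \<le> norm (v - D w) + norm (D w)"
        using norm_triangle_ineq[of "v - D w" "D w"] by simp
      also have "\<dots> \<le> (e + KD) * norm w"
        using vw KD(2)[of w] by (simp add: algebra_simps)
      also have "\<dots> \<le> (KD + 1) * norm w"
        using e by (intro mult_right_mono) auto
      finally have v: "norm v \<le> (KD + 1) * norm w" .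
      \<comment> \<open>\<open>F y\<close> is close to \<open>F' x v\<close>, and \<open>v\<close>
        is close to \<open>D w\<close>; the lower bound on \<open>F' x (D w)\<close> therefore
        passes to \<open>F y\<close> up to errors of size \<open>e\<close>.\<close>
      have "c1 * norm w \<le> norm (F' x (D w))"
        using c1(2) lw(2) by blast
      also have "\<dots> = norm (F y - (F y - F' x v) - F' x (v - D w))"
        by (simp add: A.diff)
      also have "\<dots> \<le> norm (F y) + norm (F y - F' x v) + norm (F' x (v - D w))"
        by (meson add_le_cancel_right norm_triangle_ineq4 order_trans)
      also have "\<dots> \<le> norm (F y) + e * norm v + (e * norm w) * KA"
        using Fy KA vw by (smt (verit) mult_right_mono)
      also have "\<dots> \<le> norm (F y) + e * ((KD + 1) * norm w) + (e * norm w) * KA"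
        using v e by simp
      also have "\<dots> = norm (F y) + e * (KA + KD + 1) * norm w"
        by (simp add: algebra_simps)
      also have "\<dots> \<le> norm (F y) + c1 / 2 * norm w"
        using mult_right_mono[OF e2 norm_ge_zero[of w]] by simp
      finally have Fw: "c1 / 2 * norm w \<le> norm (F y)"
        by simp
      have "c * norm v \<le> c * ((KD + 1) * norm w)"
        using v c1 KD by (intro mult_left_mono) (auto simp: c_def)
      also have "\<dots> = c1 / 2 * norm w"
        using KD by (simp add: c_def field_simps)
      finally have "c * norm (y - p) \<le> norm (F y)"
        using Fw by (simp add: v_def)
      with p show ?thesis by blast
    qed
    then show ?thesis
      using \<delta>(1) by blast
  qed
  moreover have "0 < c"
    using c1 KD by (simp add: c_def)
  ultimately show thesis
    using that by blast
qed

text \<open>The Lojasiewicz inequality with exponent 1/2. Both sides are compared with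
  \<open>(norm (z - p))\<^sup>2\<close> for the equilibrium \<open>p\<close> attached to
  \<open>z\<close>: the energy gap is at most a multiple of it, the squared field at least a
  multiple.\<close>

lemma field_energy_bound:
  assumes x: "x \<in> U" "F x = 0"
    and M: "submanifold d (U \<inter> equilibria F)"
    and ker: "dim {v. F' x v = 0} = d"
  obtains \<delta> c where "0 < \<delta>" "0 < c" "\<And>z. z \<in> ball x \<delta> \<Longrightarrow> c * \<bar>E z - E x\<bar> \<le> (norm (F z))\<^sup>2"
proof -
  interpret A: bounded_linear "F' x" by (rule F'_bounded_linear)
  obtain K where K: "K > 0" "\<And>v. norm (F' x v) \<le> norm v * K"
    using A.pos_bounded by blast
  obtain r where r: "0 < r" "\<And>p z. p \<in> ball x r \<Longrightarrow> z \<in> ball x r \<Longrightarrow> F p = 0 \<Longrightarrow>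
       \<bar>E z - E p + ((z - p) \<bullet> F' x (z - p)) / 2\<bar> \<le> 1 * (norm (z - p))\<^sup>2"
    using energy_expansion[of 1 x] by (metis zero_less_one)
  obtain \<delta> c where \<delta>: "0 < \<delta>" "0 < c" "\<And>y. y \<in> ball x \<delta> \<Longrightarrow>
       \<exists>p \<in> ball x r. F p = 0 \<and> E p = E x \<and> c * norm (y - p) \<le> norm (F y)"
    using norm_field_ge_distance_equilibrium[OF x M ker] r(1) by metis
  have "c\<^sup>2 / (K + 1) * \<bar>E z - E x\<bar> \<le> (norm (F z))\<^sup>2" if z: "z \<in> ball x (min \<delta> r)" for z
  proof -
    obtain p where p: "p \<in> ball x r" "F p = 0" "E p = E x" "c * norm (z - p) \<le> norm (F z)"
      using \<delta>(3)[of z] z by auto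
    have "\<bar>(z - p) \<bullet> F' x (z - p)\<bar> \<le> norm (z - p) * norm (F' x (z - p))"
      by (rule Cauchy_Schwarz_ineq2)
    also have "\<dots> \<le> norm (z - p) * (norm (z - p) * K)"
      by (intro mult_left_mono K) auto
    finally have "\<bar>(z - p) \<bullet> F' x (z - p)\<bar> \<le> K * (norm (z - p))\<^sup>2"
      by (simp add: power2_eq_square mult_ac)
    moreover have "\<bar>E z - E p + ((z - p) \<bullet> F' x (z - p)) / 2\<bar> \<le> (norm (z - p))\<^sup>2"
      using r(2)[of p z] p z by auto
    moreover have "0 \<le> K * (norm (z - p))\<^sup>2"
      using K by simp
    ultimately have "\<bar>E z - E x\<bar> \<le> K * (norm (z - p))\<^sup>2 + (norm (z - p))\<^sup>2"
      using p(3) by argo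
    then have "\<bar>E z - E x\<bar> \<le> (K + 1) * (norm (z - p))\<^sup>2"
      by (simp add: algebra_simps)
    then have "c\<^sup>2 / (K + 1) * \<bar>E z - E x\<bar> \<le> c\<^sup>2 / (K + 1) * ((K + 1) * (norm (z - p))\<^sup>2)"
      using K by (intro mult_left_mono) auto
    also have "\<dots> = (c * norm (z - p))\<^sup>2"
      using K by (simp add: power_mult_distrib)
    also have "\<dots> \<le> (norm (F z))\<^sup>2"
      using p(4) \<delta>(2) by (intro power_mono) auto
    finally show ?thesis .
  qed
  then show thesis
    using that[of "min \<delta> r" "c\<^sup>2 / (K + 1)"] \<delta> r K by auto
qed

section \<open>Local minimality from a semidefinite Hessian\<close>

text \<open>For a symmetric semidefinite operator \<open>B\<close>, nonnegativity of the quadratic form at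
  \<open>v - t *\<^sub>R B v\<close> gives \<open>(norm (B v))\<^sup>2 \<le> K * (v \<bullet> B v)\<close>. Here \<open>B = - F' x\<close> and \<open>t = 1 / K\<close>.\<close>

lemma negative_semidefinite_coercive:
  assumes nsd: "\<And>v. v \<bullet> F' x v \<le> 0" and K: "K > 0" "\<And>v. norm (F' x v) \<le> norm v * K"
  shows "(norm (F' x v))\<^sup>2 \<le> - K * (v \<bullet> F' x v)"
proof -
  interpret A: bounded_linear "F' x" by (rule F'_bounded_linear)
  define w where "w = F' x v"
  have "(v + (1 / K) *\<^sub>R w) \<bullet> F' x (v + (1 / K) *\<^sub>R w) \<le> 0"
    by (rule nsd)
  also have "(v + (1 / K) *\<^sub>R w) \<bullet> F' x (v + (1 / K) *\<^sub>R w) =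
      v \<bullet> w + 2 / K * (norm w)\<^sup>2 + (1 / K)\<^sup>2 * (w \<bullet> F' x w)"
    using F'_sym[of x v w]
    by (simp add: A.add A.scaleR inner_add_left inner_add_right w_def power2_norm_eq_inner
        power2_eq_square[of "1 / K"] algebra_simps)
  finally have 1: "v \<bullet> w + 2 / K * (norm w)\<^sup>2 + (1 / K)\<^sup>2 * (w \<bullet> F' x w) \<le> 0" .
  have "\<bar>w \<bullet> F' x w\<bar> \<le> norm w * (norm w * K)"
    using Cauchy_Schwarz_ineq2[of w "F' x w"] K(2)[of w] by (meson mult_left_mono norm_ge_zero order_trans)
  then have "- (K * (norm w)\<^sup>2) \<le> w \<bullet> F' x w"
    by (simp add: power2_eq_square mult_ac)
  then have "(1 / K)\<^sup>2 * (- (K * (norm w)\<^sup>2)) \<le> (1 / K)\<^sup>2 * (w \<bullet> F' x w)"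
    by (rule mult_left_mono) simp
  then have "v \<bullet> w + 2 / K * (norm w)\<^sup>2 - (norm w)\<^sup>2 / K \<le> 0"
    using 1 K(1) by (simp add: power2_eq_square)
  then have "K * (K * (v \<bullet> w) + (norm w)\<^sup>2) \<le> 0"
    using K(1) by (simp add: field_simps)
  then show ?thesis
    using K(1) by (simp add: w_def mult_le_0_iff)
qed

text \<open>The Hessian may be degenerate, but it is coercive on the displacements
  \<open>z - p\<close>, so the quadratic term dominates the error. The order of choices is
  \<open>c\<close>, then the tolerance \<open>e\<close>, then \<open>r\<close>.\<close>

lemma negative_semidefinite_imp_local_min:
  assumes x: "x \<in> U" "F x = 0"
    and M: "submanifold d (U \<inter> equilibria F)"
    and ker: "dim {v. F' x v = 0} = d"
    and nsd: "\<And>v. v \<bullet> F' x v \<le> 0"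
  obtains \<delta> where "0 < \<delta>" "\<And>z. z \<in> ball x \<delta> \<Longrightarrow> E x \<le> E z"
proof -
  interpret A: bounded_linear "F' x" by (rule F'_bounded_linear)
  obtain K where K: "K > 0" "\<And>v. norm (F' x v) \<le> norm v * K"
    using A.pos_bounded by blast
  obtain c where c: "0 < c" "\<And>r. 0 < r \<Longrightarrow> \<exists>\<delta>>0. \<forall>y \<in> ball x \<delta>. \<exists>p \<in> ball x r.
       F p = 0 \<and> E p = E x \<and> c * norm (y - p) \<le> norm (F y)"
    using norm_field_ge_distance_equilibrium[OF x M ker] by blast
  \<comment> \<open>The first entry leaves \<open>c / 2 * norm v \<le> norm (F' x v)\<close>.
    Coercivity turns this into a quadratic term of at least
    \<open>c\<^sup>2 / (8 * K) * (norm v)\<^sup>2\<close>, and the second entry keeps the error no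
    larger than that.\<close>
  define e where "e = min (c / 2) (c\<^sup>2 / (8 * K))"
  have e: "0 < e" "e \<le> c / 2" "e \<le> c\<^sup>2 / (8 * K)"
    using c(1) K(1) by (auto simp: e_def)
  obtain r where r: "0 < r" "\<And>p z. p \<in> ball x r \<Longrightarrow> z \<in> ball x r \<Longrightarrow> F p = 0 \<Longrightarrow>
       norm (F z - F' x (z - p)) \<le> e * norm (z - p) \<and>
       \<bar>E z - E p + ((z - p) \<bullet> F' x (z - p)) / 2\<bar> \<le> e * (norm (z - p))\<^sup>2"
    using energy_expansion[OF e(1), of x] by metis
  obtain \<delta> where \<delta>: "0 < \<delta>" "\<And>y. y \<in> ball x \<delta> \<Longrightarrow>
       \<exists>p \<in> ball x r. F p = 0 \<and> E p = E x \<and> c * norm (y - p) \<le> norm (F y)"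
    using c(2)[OF r(1)] by blast
  have "E x \<le> E z" if z: "z \<in> ball x (min \<delta> r)" for z
  proof -
    obtain p where p: "p \<in> ball x r" "F p = 0" "E p = E x" "c * norm (z - p) \<le> norm (F z)"
      using \<delta>(2)[of z] z by auto
    define v where "v = z - p"
    have v: "norm (F z - F' x v) \<le> e * norm v"
      "\<bar>E z - E x + (v \<bullet> F' x v) / 2\<bar> \<le> e * (norm v)\<^sup>2"
      using r(2)[of p z] p z by (auto simp: v_def)
    have "c * norm v \<le> norm (F' x v) + e * norm v"
      using p(4) v(1) norm_triangle_ineq2[of "F z" "F' x v"] by (simp add: v_def)
    moreover have "e * norm v \<le> c / 2 * norm v"
      using e(2) by (rule mult_right_mono) simp
    ultimately have "c / 2 * norm v \<le> norm (F' x v)"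
      by simp
    then have "(c / 2 * norm v)\<^sup>2 \<le> (norm (F' x v))\<^sup>2"
      using c(1) by (intro power_mono) auto
    also have "\<dots> \<le> - K * (v \<bullet> F' x v)"
      by (rule negative_semidefinite_coercive[OF nsd K])
    finally have "c\<^sup>2 / (8 * K) * (norm v)\<^sup>2 \<le> - (v \<bullet> F' x v) / 2"
      using K(1) by (simp add: power_mult_distrib power_divide field_simps)
    moreover have "e * (norm v)\<^sup>2 \<le> c\<^sup>2 / (8 * K) * (norm v)\<^sup>2"
      using e(3) by (rule mult_right_mono) simp
    ultimately show ?thesis
      using v(2) by argo
  qed
  then show thesis
    using that[of "min \<delta> r"] \<delta>(1) r(1) by auto
qed

section \<open>Energy and length of trajectories\<close>

lemma energy_along_solution:
  assumes "solution_on F I \<gamma>" "t \<in> I"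
  shows "((\<lambda>t. E (\<gamma> t)) has_real_derivative - (norm (F (\<gamma> t)))\<^sup>2) (at t within I)"
proof -
  have "(\<gamma> has_derivative (\<lambda>h. h *\<^sub>R F (\<gamma> t))) (at t within I)"
    using assms by (auto simp: solution_on_def has_vector_derivative_def)
  from has_derivative_compose[OF this E_deriv]
  show ?thesis
    by (rule has_derivative_imp_has_field_derivative) (simp add: power2_norm_eq_inner)
qed

lemma solution_continuous_on: "solution_on F I \<gamma> \<Longrightarrow> continuous_on I \<gamma>"
  unfolding solution_on_def continuous_on_eq_continuous_within
  using has_vector_derivative_continuous by blast

lemma solution_on_interior:
  assumes "solution_on F {a..b} \<gamma>" "a < t" "t < b"
  shows "(\<gamma> has_vector_derivative F (\<gamma> t)) (at t)"
  using assms by (auto simp: solution_on_def at_within_Icc_at dest!: bspec[of _ _ t])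

lemma solution_on_subset: "solution_on F I \<gamma> \<Longrightarrow> J \<subseteq> I \<Longrightarrow> solution_on F J \<gamma>"
  unfolding solution_on_def using has_vector_derivative_within_subset by blast

lemma energy_antimono:
  assumes \<gamma>: "solution_on F {a..b} \<gamma>" and st: "a \<le> s" "s \<le> t" "t \<le> b"
  shows "E (\<gamma> t) \<le> E (\<gamma> s)"
proof (rule DERIV_nonpos_imp_decreasing_open[OF st(2)])
  show "\<exists>y. ((\<lambda>t. E (\<gamma> t)) has_real_derivative y) (at u) \<and> y \<le> 0" if "s < u" "u < t" for u
    using energy_along_solution[OF \<gamma>, of u] that st by (intro exI) (auto simp: at_within_Icc_at)
  show "continuous_on {s..t} (\<lambda>t. E (\<gamma> t))"
    using solution_continuous_on[OF solution_on_subset[OF \<gamma>, of "{s..t}"]] st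
    by (intro continuous_on_compose2[OF E_continuous_on[of UNIV]]) auto
qed

text \<open>As long as the energy exceeds its minimum \<open>m\<close>, the square root of the excess decreases at
  least as fast as a multiple of the arc length grows; once the excess vanishes, so does the
  velocity. This is why the interval is split at the first zero \<open>t1\<close> of the excess.\<close>

lemma solution_length_bound:
  assumes \<gamma>: "solution_on F {0..T} \<gamma>" and T: "0 \<le> T" and c: "0 < c"
    and B: "\<And>t. t \<in> {0..T} \<Longrightarrow> m \<le> E (\<gamma> t)"
      "\<And>t. t \<in> {0..T} \<Longrightarrow> c\<^sup>2 * (E (\<gamma> t) - m) \<le> (norm (F (\<gamma> t)))\<^sup>2"
  shows "norm (\<gamma> T - \<gamma> 0) \<le> 2 / c * (sqrt (E (\<gamma> 0) - m) - sqrt (E (\<gamma> T) - m))"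
proof -
  define Z where "Z = {t \<in> {0..T}. E (\<gamma> t) - m = 0}"
  have E\<gamma>: "continuous_on {0..T} (\<lambda>t. E (\<gamma> t))"
    using solution_continuous_on[OF \<gamma>]
    by (intro continuous_on_compose2[OF E_continuous_on[of UNIV]]) auto
  obtain t1 where t1: "t1 \<in> {0..T}" "\<And>t. t \<in> {0..<t1} \<Longrightarrow> E (\<gamma> t) - m > 0"
    "t1 < T \<Longrightarrow> E (\<gamma> t1) = m"
  proof (cases "Z = {}")
    case True
    then have "E (\<gamma> t) - m > 0" if "t \<in> {0..T}" for t
      using that B(1)[OF that] by (force simp: Z_def)
    then show thesis
      using that[of T] T by auto
  next
    case False
    have "closed Z"
      unfolding Z_def using E\<gamma> by (intro continuous_closed_preimage_constant continuous_intros) auto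
    then have "compact Z"
      by (auto simp: compact_eq_bounded_closed Z_def intro: bounded_subset[OF bounded_closed_interval])
    then obtain t1 where t1: "t1 \<in> Z" "\<And>t. t \<in> Z \<Longrightarrow> t1 \<le> t"
      using compact_attains_inf[OF _ False] by blast
    have "E (\<gamma> t) - m > 0" if t: "t \<in> {0..<t1}" for t
    proof -
      have "t \<in> {0..T}"
        using t t1(1) by (auto simp: Z_def)
      moreover have "t \<notin> Z"
        using t1(2)[of t] t by auto
      ultimately show ?thesis
        using B(1)[of t] by (auto simp: Z_def)
    qed
    then show thesis
      using that[of t1] t1(1) by (auto simp: Z_def)
  qed
  have before: "norm (\<gamma> t1 - \<gamma> 0) \<le> 2 / c * (sqrt (E (\<gamma> 0) - m) - sqrt (E (\<gamma> t1) - m))"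
  proof (cases "t1 = 0")
    case False
    \<comment> \<open>The derivative of \<Phi> is \<open>(norm (F (\<gamma> t)))\<^sup>2 / (c * sqrt
      (E (\<gamma> t) - m))\<close>, which dominates the speed because the field is at least
      \<open>c * sqrt (E (\<gamma> t) - m)\<close>.\<close>
    define \<Phi> where "\<Phi> t = - (2 / c) * sqrt (E (\<gamma> t) - m)" for t
    have "norm (\<gamma> t1 - \<gamma> 0) \<le> \<Phi> t1 - \<Phi> 0"
    proof (rule differentiable_bound_general)
      show "0 < t1"
        using False t1(1) by auto
      show "continuous_on {0..t1} \<gamma>"
        using t1(1) by (intro continuous_on_subset[OF solution_continuous_on[OF \<gamma>]]) auto
      show "continuous_on {0..t1} \<Phi>"
        unfolding \<Phi>_def using continuous_on_subset[OF E\<gamma>, of "{0..t1}"] t1(1)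
        by (intro continuous_intros) auto
      fix t assume t: "0 < t" "t < t1"
      then have t': "0 < t" "t < T" "t \<in> {0..T}"
        using t1(1) by auto
      have pos: "E (\<gamma> t) - m > 0"
        using t1(2)[of t] t by auto
      show "(\<gamma> has_vector_derivative F (\<gamma> t)) (at t)"
        using solution_on_interior[OF \<gamma>] t' by blast
      have "((\<lambda>t. E (\<gamma> t)) has_real_derivative - (norm (F (\<gamma> t)))\<^sup>2) (at t)"
        using energy_along_solution[OF \<gamma>, of t] t' by (simp add: at_within_Icc_at)
      then have "(\<Phi> has_real_derivative (norm (F (\<gamma> t)))\<^sup>2 / (c * sqrt (E (\<gamma> t) - m))) (at t)"
        unfolding \<Phi>_def using pos c
        by (auto intro!: derivative_eq_intros simp: field_simps)
      then show "(\<Phi> has_vector_derivative (norm (F (\<gamma> t)))\<^sup>2 / (c * sqrt (E (\<gamma> t) - m))) (at t)"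
        by (simp add: has_real_derivative_iff_has_vector_derivative)
      have "(c * sqrt (E (\<gamma> t) - m))\<^sup>2 \<le> (norm (F (\<gamma> t)))\<^sup>2"
        using B(2)[OF t'(3)] pos by (simp add: power_mult_distrib)
      then have "c * sqrt (E (\<gamma> t) - m) \<le> norm (F (\<gamma> t))"
        by (rule power2_le_imp_le) simp
      then have "norm (F (\<gamma> t)) * (c * sqrt (E (\<gamma> t) - m)) \<le> (norm (F (\<gamma> t)))\<^sup>2"
        by (simp add: power2_eq_square mult_left_mono)
      then show "norm (F (\<gamma> t)) \<le> (norm (F (\<gamma> t)))\<^sup>2 / (c * sqrt (E (\<gamma> t) - m))"
        using c pos by (simp add: pos_le_divide_eq)
    qed
    then show ?thesis
      by (simp add: \<Phi>_def algebra_simps)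
  qed auto
  have after: "\<gamma> T = \<gamma> t1"
  proof (cases "t1 = T")
    case False
    then have t1T: "t1 < T" "0 \<le> t1"
      using t1(1) by auto
    \<comment> \<open>The energy can neither rise again nor drop below \<open>m\<close>. Being
      constant, it has derivative 0, which forces zero velocity.\<close>
    have zero: "E (\<gamma> t) = m" if "t \<in> {t1..T}" for t
      using energy_antimono[OF \<gamma>, of t1 t] that t1T t1(3) B(1)[of t] by auto
    have "norm (\<gamma> T - \<gamma> t1) \<le> (\<lambda>_. 0) T - (\<lambda>_. 0::real) t1"
    proof (rule differentiable_bound_general[OF t1T(1)])
      show "continuous_on {t1..T} \<gamma>"
        using solution_continuous_on[OF \<gamma>] t1T by (auto intro: continuous_on_subset)
      fix t assume t: "t1 < t" "t < T"
      then show "(\<gamma> has_vector_derivative F (\<gamma> t)) (at t)"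
        using solution_on_interior[OF \<gamma>] t1T by auto
      have 1: "((\<lambda>t. E (\<gamma> t)) has_real_derivative - (norm (F (\<gamma> t)))\<^sup>2) (at t)"
        using energy_along_solution[OF \<gamma>, of t] t t1T by (simp add: at_within_Icc_at)
      have "((\<lambda>t. E (\<gamma> t)) has_real_derivative 0) (at t)"
        by (rule has_field_derivative_transform_within_open[where f = "\<lambda>_. m" and S = "{t1<..<T}"])
          (use zero t in auto)
      from DERIV_unique[OF 1 this] show "norm (F (\<gamma> t)) \<le> 0"
        by simp
    qed auto
    then show ?thesis by simp
  qed simp
  show ?thesis
    using before unfolding after .
qed

text \<open>The invariant neighborhood is a sublevel set of \<open>V\<close>: the distance to
  \<open>y\<close> plus the length that the remaining energy excess still allows. By the length
  bound, \<open>V\<close> never exceeds its initial value while the trajectory remains in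
  \<open>ball y r\<close>.\<close>

lemma lyapunov_stable_local_min:
  assumes r: "0 < r" and c: "0 < c"
    and min: "\<And>z. z \<in> ball y r \<Longrightarrow> E y \<le> E z"
    and bound: "\<And>z. z \<in> ball y r \<Longrightarrow> c * (E z - E y) \<le> (norm (F z))\<^sup>2"
  shows "lyapunov_stable F y"
  unfolding lyapunov_stable_def
proof (intro allI impI)
  fix W assume "y \<in> interior W"
  then obtain r' where r': "0 < r'" "ball y r' \<subseteq> W"
    using mem_interior by blast
  define \<rho> where "\<rho> = min r r' / 2"
  have \<rho>: "0 < \<rho>" "\<rho> < r" "\<rho> < r'"
    using r r' by (auto simp: \<rho>_def)
  define V where "V z = norm (z - y) + 2 / sqrt c * sqrt (E z - E y)" for z
  define S where "S = {z \<in> ball y \<rho>. V z < \<rho>}"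
  have V_cont: "continuous_on UNIV V"
    unfolding V_def by (intro continuous_intros E_continuous_on)
  have "open {z. V z < \<rho>}"
    using V_cont by (intro open_Collect_less) auto
  then have "open S"
    unfolding S_def Collect_conj_eq by (intro open_Int) (simp_all add: open_ball[unfolded ball_def])
  moreover have "y \<in> S"
    using \<rho> by (simp add: S_def V_def)
  ultimately have "y \<in> interior S"
    by (simp add: interior_open)
  moreover have "S \<subseteq> W"
    using r' \<rho> by (auto simp: S_def)
  moreover have "forward_invariant F S"
    unfolding forward_invariant_def
  proof (intro allI impI ballI, elim conjE)
    fix \<gamma> :: "real \<Rightarrow> 'a" and T t :: real
    assume T: "0 \<le> T" and \<gamma>: "solution_on F {0..T} \<gamma>" and S0: "\<gamma> 0 \<in> S" and t: "t \<in> {0..T}"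
    have V_le: "V (\<gamma> s) \<le> V (\<gamma> 0)" if s: "s \<in> {0..T}" and in_ball: "\<And>u. u \<in> {0..s} \<Longrightarrow> \<gamma> u \<in> ball y r" for s
    proof -
      have "solution_on F {0..s} \<gamma>"
        using \<gamma> s by (auto intro: solution_on_subset)
      then have "norm (\<gamma> s - \<gamma> 0) \<le> 2 / sqrt c * (sqrt (E (\<gamma> 0) - E y) - sqrt (E (\<gamma> s) - E y))"
        using s c min bound in_ball by (intro solution_length_bound) auto
      then show ?thesis
        using norm_triangle_ineq[of "\<gamma> s - \<gamma> 0" "\<gamma> 0 - y"] by (simp add: V_def algebra_simps)
    qed
    \<comment> \<open>First exit argument: at the first time \<open>s\<close> outside the open ball,
      continuity still puts \<open>\<gamma> s\<close> in the closed ball, inside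
      \<open>ball y r\<close>. There \<open>V\<close> is below \<rho> and dominates the distance to
      \<open>y\<close>, a contradiction.\<close>
    have in_\<rho>: "\<gamma> u \<in> ball y \<rho>" if u: "u \<in> {0..T}" for u
    proof (rule ccontr)
      assume "\<gamma> u \<notin> ball y \<rho>"
      define Z where "Z = {0..T} \<inter> \<gamma> -` (- ball y \<rho>)"
      have "Z \<noteq> {}"
        using u \<open>\<gamma> u \<notin> ball y \<rho>\<close> by (auto simp: Z_def)
      have "closed Z"
        unfolding Z_def by (intro continuous_closed_preimage solution_continuous_on[OF \<gamma>]) auto
      moreover have "bounded Z"
        by (rule bounded_subset[OF bounded_closed_interval[of 0 T]]) (auto simp: Z_def)
      ultimately have "compact Z"
        by (simp add: compact_eq_bounded_closed)
      then obtain s where s: "s \<in> Z" "\<And>t. t \<in> Z \<Longrightarrow> s \<le> t"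
        using compact_attains_inf \<open>Z \<noteq> {}\<close> by metis
      have s': "s \<in> {0..T}" "\<gamma> s \<notin> ball y \<rho>"
        using s(1) by (auto simp: Z_def)
      have before: "\<gamma> t \<in> ball y \<rho>" if "t \<in> {0..<s}" for t
        using s(2)[of t] that s' by (force simp: Z_def)
      have "s \<noteq> 0"
        using s' S0 by (auto simp: S_def)
      then have "0 < s"
        using s' by auto
      have "\<gamma> s \<in> cball y \<rho>"
      proof -
        have "(\<gamma> \<longlongrightarrow> \<gamma> s) (at s within {0..s})"
          using solution_continuous_on[OF solution_on_subset[OF \<gamma>, of "{0..s}"]] s' \<open>0 < s\<close>
          by (auto simp: continuous_on_def)
        moreover have "\<forall>\<^sub>F t in at s within {0..s}. \<gamma> t \<in> cball y \<rho>"
          unfolding eventually_at using before by (intro exI[of _ 1]) (force simp: less_imp_le)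
        moreover have "at s within {0..s} \<noteq> bot"
          using \<open>0 < s\<close> by (simp add: trivial_limit_within islimpt_Icc)
        ultimately show ?thesis
          using Lim_in_closed_set[OF closed_cball] by blast
      qed
      then have "\<gamma> u \<in> ball y r" if "u \<in> {0..s}" for u
        using before[of u] that \<rho> by (cases "u = s") (auto simp: less_imp_le)
      from V_le[OF s'(1) this] have "V (\<gamma> s) < \<rho>"
        using S0 by (simp add: S_def)
      moreover have "E y \<le> E (\<gamma> s)"
        using \<open>\<gamma> s \<in> cball y \<rho>\<close> \<rho> by (intro min) auto
      then have "norm (\<gamma> s - y) \<le> V (\<gamma> s)"
        using c by (simp add: V_def)
      ultimately show False
        using s'(2) by (simp add: dist_norm norm_minus_commute)
    qed
    have "\<gamma> u \<in> ball y r" if "u \<in> {0..t}" for u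
      using in_\<rho>[of u] that t \<rho> by auto
    from V_le[OF t this] show "\<gamma> t \<in> S"
      using S0 in_\<rho>[OF t] by (auto simp: S_def)
  qed
  ultimately show "\<exists>S\<subseteq>W. y \<in> interior S \<and> forward_invariant F S"
    by blast
qed

section \<open>Instability\<close>

text \<open>One time \<tau> serves all starting points near \<open>x\<close>, so that trajectories
  can be restarted. Composing \<open>F\<close> with the nearest-point projection onto a ball makes
  it bounded and globally Lipschitz without altering it on the ball.\<close>

lemma short_time_solution:
  obtains R \<tau> where "0 < R" "0 < \<tau>"
    "\<And>x0. x0 \<in> cball x R \<Longrightarrow> \<exists>\<gamma>. solution_on F {0..\<tau>} \<gamma> \<and> \<gamma> 0 = x0"
proof -
  interpret A: bounded_linear "F' x" by (rule F'_bounded_linear)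
  obtain K where K: "K > 0" "\<And>v. norm (F' x v) \<le> norm v * K"
    using A.pos_bounded by blast
  obtain \<delta> where \<delta>: "0 < \<delta>" "\<And>u w. u \<in> ball x \<delta> \<Longrightarrow> w \<in> ball x \<delta> \<Longrightarrow>
      norm (F u - F w - F' x (u - w)) \<le> 1 * norm (u - w)"
    using F_strict[of 1 x] by (metis zero_less_one)
  define C where "C = cball x (\<delta> / 2)"
  define \<pi> where "\<pi> = closest_point C"
  define L where "L = K + 1"
  define B where "B = norm (F x) + L * \<delta>"
  \<comment> \<open>The first entry makes Picard iteration a contraction. The second bounds the
    displacement by \<open>\<delta> / 4\<close>, so solutions from
    \<open>cball x (\<delta> / 4)\<close> stay in \<open>C\<close>, where the projection is the
    identity.\<close>
  define \<tau> where "\<tau> = min (1 / (2 * L)) (\<delta> / (4 * B))"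
  have C: "convex C" "closed C" "C \<noteq> {}" "x \<in> C" "C \<subseteq> ball x \<delta>"
    using \<delta> by (auto simp: C_def)
  have \<pi>: "\<pi> u \<in> C" for u
    unfolding \<pi>_def using C by (intro closest_point_in_set)
  have F_lip: "norm (F u - F w) \<le> L * norm (u - w)" if "u \<in> C" "w \<in> C" for u w
  proof -
    have "norm (F u - F w) \<le> norm (F u - F w - F' x (u - w)) + norm (F' x (u - w))"
      using norm_triangle_ineq[of "F u - F w - F' x (u - w)" "F' x (u - w)"] by simp
    also have "\<dots> \<le> 1 * norm (u - w) + norm (u - w) * K"
      using that C(5) by (intro add_mono \<delta>(2) K(2)) auto
    finally show ?thesis
      by (simp add: L_def algebra_simps)
  qed
  have L: "0 < L" and B: "0 < B"
    using K \<delta> by (auto simp: L_def B_def intro!: add_nonneg_pos)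
  have lip: "norm (F (\<pi> u) - F (\<pi> w)) \<le> L * norm (u - w)" for u w
  proof -
    have "norm (F (\<pi> u) - F (\<pi> w)) \<le> L * norm (\<pi> u - \<pi> w)"
      by (intro F_lip \<pi>)
    also have "\<dots> \<le> L * norm (u - w)"
      using closest_point_lipschitz[OF C(1-3), of u w] L by (simp add: \<pi>_def dist_norm)
    finally show ?thesis .
  qed
  have bound: "norm (F (\<pi> u)) \<le> B" for u
  proof -
    have "norm (F (\<pi> u)) \<le> norm (F x) + norm (F (\<pi> u) - F x)"
      using norm_triangle_ineq[of "F x" "F (\<pi> u) - F x"] by simp
    also have "norm (F (\<pi> u) - F x) \<le> L * norm (\<pi> u - x)"
      by (intro F_lip \<pi> C)
    also have "\<dots> \<le> L * \<delta>"
      using \<pi>[of u] L \<delta>(1) by (intro mult_left_mono) (auto simp: C_def dist_norm norm_minus_commute)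
    finally show ?thesis
      by (simp add: B_def)
  qed
  have \<tau>: "0 < \<tau>" "L * \<tau> \<le> 1 / 2" "B * \<tau> \<le> \<delta> / 4"
  proof -
    show "0 < \<tau>"
      using L B \<delta> by (simp add: \<tau>_def)
    have "L * \<tau> \<le> L * (1 / (2 * L))"
      using L by (intro mult_left_mono) (auto simp: \<tau>_def)
    then show "L * \<tau> \<le> 1 / 2"
      using L by simp
    have "B * \<tau> \<le> B * (\<delta> / (4 * B))"
      using B by (intro mult_left_mono) (auto simp: \<tau>_def)
    then show "B * \<tau> \<le> \<delta> / 4"
      using B by simp
  qed
  have "\<exists>\<gamma>. solution_on F {0..\<tau>} \<gamma> \<and> \<gamma> 0 = x0" if x0: "x0 \<in> cball x (\<delta> / 4)" for x0
  proof -
    obtain \<gamma> where \<gamma>: "solution_on (\<lambda>u. F (\<pi> u)) {0..\<tau>} \<gamma>" "\<gamma> 0 = x0"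
      "\<And>t. t \<in> {0..\<tau>} \<Longrightarrow> norm (\<gamma> t - x0) \<le> B * \<tau>"
      using lipschitz_bounded_solution[of "\<lambda>u. F (\<pi> u)" L B \<tau> x0] lip bound \<tau> L by (metis less_imp_le)
    have "\<pi> (\<gamma> t) = \<gamma> t" if t: "t \<in> {0..\<tau>}" for t
    proof -
      have "norm (\<gamma> t - x) \<le> norm (\<gamma> t - x0) + norm (x0 - x)"
        using norm_triangle_ineq[of "\<gamma> t - x0" "x0 - x"] by simp
      also have "\<dots> \<le> \<delta> / 4 + \<delta> / 4"
        using \<gamma>(3)[OF t] \<tau>(3) x0 by (intro add_mono) (auto simp: dist_norm norm_minus_commute)
      finally have "\<gamma> t \<in> C"
        by (simp add: C_def dist_norm norm_minus_commute)
      then show ?thesis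
        by (simp add: \<pi>_def closest_point_self)
    qed
    then have "solution_on F {0..\<tau>} \<gamma>"
      using \<gamma>(1) by (simp add: solution_on_def)
    with \<gamma>(2) show ?thesis by blast
  qed
  then show thesis
    using that[of "\<delta> / 4" \<tau>] \<tau>(1) \<delta>(1) by simp
qed

text \<open>Starting at lower energy than \<open>x\<close> inside a small invariant set, the gradient bound forces the
  energy to drop by a fixed amount \<open>\<eta> * \<tau>\<close> in each time step, although it is bounded below there.\<close>

lemma lyapunov_stable_imp_energy_ge:
  assumes stable: "lyapunov_stable F x" and r: "0 < r" and c: "0 < c"
    and bound: "\<And>z. z \<in> ball x r \<Longrightarrow> c * \<bar>E z - E x\<bar> \<le> (norm (F z))\<^sup>2"
  obtains \<delta> where "0 < \<delta>" "\<And>z. z \<in> ball x \<delta> \<Longrightarrow> E x \<le> E z"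
proof -
  obtain R \<tau> where R: "0 < R" "0 < \<tau>"
    "\<And>x0. x0 \<in> cball x R \<Longrightarrow> \<exists>\<gamma>. solution_on F {0..\<tau>} \<gamma> \<and> \<gamma> 0 = x0"
    using short_time_solution by blast
  \<comment> \<open>Radius \<open>R\<close> permits a restart from every point of \<open>S\<close>;
    radius \<open>r\<close> makes the energy bound available there.\<close>
  define W where "W = ball x (min r R)"
  have "x \<in> interior W"
    using r R by (simp add: W_def interior_open)
  then obtain S where S: "S \<subseteq> W" "x \<in> interior S" "forward_invariant F S"
    using stable unfolding lyapunov_stable_def by blast
  obtain \<delta> where \<delta>: "0 < \<delta>" "ball x \<delta> \<subseteq> S"
    using S(2) mem_interior by blast
  have "E x \<le> E z0" if z0: "z0 \<in> ball x \<delta>" for z0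
  proof (rule ccontr)
    assume "\<not> E x \<le> E z0"
    \<comment> \<open>While the energy is at most \<open>E z0\<close>, the squared field is at least
      \<eta>, so the energy falls at least at rate \<eta>.\<close>
    define \<eta> where "\<eta> = c * (E x - E z0)"
    have \<eta>: "0 < \<eta>"
      using c \<open>\<not> E x \<le> E z0\<close> by (simp add: \<eta>_def)
    have step: "\<exists>z'\<in>S. E z' \<le> E z - \<eta> * \<tau>" if z: "z \<in> S" "E z \<le> E z0" for z
    proof -
      have "z \<in> cball x R"
        using z S(1) by (auto simp: W_def)
      then obtain \<gamma> where \<gamma>: "solution_on F {0..\<tau>} \<gamma>" "\<gamma> 0 = z"
        using R(3) by blast
      have in_S: "\<gamma> t \<in> S" if "t \<in> {0..\<tau>}" for t
        using S(3) \<gamma> z(1) R(2) that unfolding forward_invariant_def by (metis less_imp_le)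
      have "E (\<gamma> \<tau>) + \<eta> * \<tau> \<le> E (\<gamma> 0) + \<eta> * 0"
      proof (rule DERIV_nonpos_imp_decreasing_open[of 0 \<tau> "\<lambda>t. E (\<gamma> t) + \<eta> * t"])
        show "continuous_on {0..\<tau>} (\<lambda>t. E (\<gamma> t) + \<eta> * t)"
          using solution_continuous_on[OF \<gamma>(1)]
          by (intro continuous_intros continuous_on_compose2[OF E_continuous_on[of UNIV]]) auto
        fix t assume t: "0 < t" "t < \<tau>"
        have "((\<lambda>t. E (\<gamma> t)) has_real_derivative - (norm (F (\<gamma> t)))\<^sup>2) (at t)"
          using energy_along_solution[OF \<gamma>(1), of t] t by (simp add: at_within_Icc_at)
        then have "((\<lambda>t. E (\<gamma> t) + \<eta> * t) has_real_derivative - (norm (F (\<gamma> t)))\<^sup>2 + \<eta>) (at t)"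
          by (auto intro!: derivative_eq_intros)
        moreover have "\<eta> \<le> (norm (F (\<gamma> t)))\<^sup>2"
        proof -
          have "E (\<gamma> t) \<le> E z0"
            using energy_antimono[OF \<gamma>(1), of 0 t] \<gamma>(2) z(2) t by simp
          then have "\<eta> \<le> c * \<bar>E (\<gamma> t) - E x\<bar>"
            using c unfolding \<eta>_def by (intro mult_left_mono) auto
          also have "\<dots> \<le> (norm (F (\<gamma> t)))\<^sup>2"
            using in_S[of t] t S(1) by (intro bound) (auto simp: W_def)
          finally show ?thesis .
        qed
        ultimately show "\<exists>y. ((\<lambda>t. E (\<gamma> t) + \<eta> * t) has_real_derivative y) (at t) \<and> y \<le> 0"
          by (intro exI conjI) auto
      qed (use R in simp)
      then show ?thesis
        using in_S[of \<tau>] R(2) \<gamma>(2) by (intro bexI[of _ "\<gamma> \<tau>"]) auto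
    qed
    \<comment> \<open>Only the endpoint of each piece is carried on, so the pieces are never glued
      into one long solution.\<close>
    have iter: "\<exists>z\<in>S. E z \<le> E z0 - real k * (\<eta> * \<tau>)" for k
    proof (induction k)
      case 0
      show ?case using z0 \<delta>(2) by auto
    next
      case (Suc k)
      then obtain z where z: "z \<in> S" "E z \<le> E z0 - real k * (\<eta> * \<tau>)" by blast
      moreover have "0 \<le> real k * (\<eta> * \<tau>)"
        using \<eta> R(2) by simp
      ultimately obtain z' where "z' \<in> S" "E z' \<le> E z - \<eta> * \<tau>"
        using step[of z] by auto
      with z show ?case
        by (intro bexI[of _ z']) (auto simp: algebra_simps)
    qed
    \<comment> \<open>By compactness \<open>E\<close> is bounded below on this ball, which contains
      \<open>S\<close>; sufficiently many steps contradict this.\<close>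
    have "\<exists>z0\<in>cball x r. \<forall>z\<in>cball x r. E z0 \<le> E z"
      using r by (intro continuous_attains_inf E_continuous_on) auto
    then obtain b where b: "\<And>z. z \<in> cball x r \<Longrightarrow> b \<le> E z"
      by blast
    obtain k where k: "E z0 - b < real k * (\<eta> * \<tau>)"
      using reals_Archimedean3[of "\<eta> * \<tau>"] \<eta> R(2) by auto
    obtain z where "z \<in> S" "E z \<le> E z0 - real k * (\<eta> * \<tau>)"
      using iter by blast
    moreover from this have "b \<le> E z"
      using S(1) by (intro b) (auto simp: W_def)
    ultimately show False
      using k by simp
  qed
  then show thesis
    using that \<delta>(1) by blast
qed

text \<open>The second-order necessary condition: as \<open>F' x\<close> is minus the Hessian, a
  direction with positive form would lower the energy below \<open>E x\<close>.\<close>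

lemma local_min_imp_negative_semidefinite:
  assumes \<delta>: "0 < \<delta>" "\<And>z. z \<in> ball x \<delta> \<Longrightarrow> E x \<le> E z" and x: "F x = 0"
  shows "v \<bullet> F' x v \<le> 0"
proof (rule ccontr)
  assume "\<not> v \<bullet> F' x v \<le> 0"
  then have pos: "0 < v \<bullet> F' x v" by simp
  interpret A: bounded_linear "F' x" by (rule F'_bounded_linear)
  have v: "v \<noteq> 0"
    using pos by auto
  \<comment> \<open>For the displacement \<open>t *\<^sub>R v\<close> the error is then a quarter of
    \<open>t\<^sup>2 * (v \<bullet> F' x v)\<close>, whereas the quadratic term lowers the energy by
    half of it.\<close>
  define e where "e = (v \<bullet> F' x v) / (4 * (norm v)\<^sup>2)"
  have e: "0 < e"
    using pos v by (simp add: e_def)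
  obtain r where r: "0 < r" "\<And>p z. p \<in> ball x r \<Longrightarrow> z \<in> ball x r \<Longrightarrow> F p = 0 \<Longrightarrow>
       norm (F z - F' x (z - p)) \<le> e * norm (z - p) \<and>
       \<bar>E z - E p + ((z - p) \<bullet> F' x (z - p)) / 2\<bar> \<le> e * (norm (z - p))\<^sup>2"
    using energy_expansion[OF e, of x] by metis
  define t where "t = min \<delta> r / (2 * norm v)"
  have t: "0 < t"
    using \<delta> r v by (simp add: t_def)
  define z where "z = x + t *\<^sub>R v"
  have "norm (z - x) = min \<delta> r / 2"
    using v \<delta> r by (simp add: z_def t_def)
  then have "z \<in> ball x \<delta>" "z \<in> ball x r"
    using \<delta> r by (auto simp: dist_norm norm_minus_commute)
  then have "E x \<le> E z" "\<bar>E z - E x + ((z - x) \<bullet> F' x (z - x)) / 2\<bar> \<le> e * (norm (z - x))\<^sup>2"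
    using \<delta>(2) r(2)[of x z] r(1) x by auto
  moreover have "(z - x) \<bullet> F' x (z - x) = t\<^sup>2 * (v \<bullet> F' x v)"
    by (simp add: z_def A.scaleR power2_eq_square)
  moreover have "e * (norm (z - x))\<^sup>2 = t\<^sup>2 * (v \<bullet> F' x v) / 4"
    using v by (simp add: z_def e_def power_mult_distrib)
  moreover have "0 < t\<^sup>2 * (v \<bullet> F' x v)"
    using t pos by simp
  ultimately show False by argo
qed

text \<open>Both directions pass through local minimality of \<open>E\<close> at \<open>x\<close>.
  The sufficiency argument treats all equilibria near \<open>x\<close> at once, which also yields
  the manifold of stable equilibria.\<close>

theorem lyapunov_stable_iff_negative_semidefinite:
  assumes x: "x \<in> U" "F x = 0"
    and M: "submanifold d (U \<inter> equilibria F)"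
    and ker: "dim {v. F' x v = 0} = d"
  shows "lyapunov_stable F x \<longleftrightarrow> (\<forall>v. v \<bullet> F' x v \<le> 0)"
    and "lyapunov_stable F x \<Longrightarrow>
      \<exists>M. submanifold d M \<and> x \<in> M \<and> (\<forall>y\<in>M. y \<in> equilibria F \<and> lyapunov_stable F y)"
proof -
  obtain r c where r: "0 < r" "0 < c" "\<And>z. z \<in> ball x r \<Longrightarrow> c * \<bar>E z - E x\<bar> \<le> (norm (F z))\<^sup>2"
    using field_energy_bound[OF x M ker] by blast
  have nsd: "v \<bullet> F' x v \<le> 0" if "lyapunov_stable F x" for v
    using lyapunov_stable_imp_energy_ge[OF that r] local_min_imp_negative_semidefinite x(2) by metis
  have near: "\<exists>\<delta>>0. \<forall>y\<in>ball x \<delta>. F y = 0 \<longrightarrow> lyapunov_stable F y" if semidef: "\<forall>v. v \<bullet> F' x v \<le> 0"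
  proof -
    obtain \<delta>' where \<delta>': "0 < \<delta>'" "\<And>z. z \<in> ball x \<delta>' \<Longrightarrow> E x \<le> E z"
      using negative_semidefinite_imp_local_min[OF x M ker] semidef by blast
    \<comment> \<open>With half the radius, a ball about any \<open>y\<close> in
      \<open>ball x \<delta>\<close> stays inside both balls about \<open>x\<close>.\<close>
    define \<delta> where "\<delta> = min \<delta>' r / 2"
    have \<delta>: "0 < \<delta>" "\<delta> + \<delta> \<le> \<delta>'" "\<delta> + \<delta> \<le> r"
      using \<delta>'(1) r(1) by (auto simp: \<delta>_def)
    have "lyapunov_stable F y" if y: "y \<in> ball x \<delta>" "F y = 0" for y
    proof (rule lyapunov_stable_local_min[OF \<delta>(1) r(2)])
      \<comment> \<open>At an equilibrium the right side of the Lojasiewicz inequality is 0, so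
        \<open>y\<close> has the energy of \<open>x\<close> and inherits its minimality.\<close>
      have "c * \<bar>E y - E x\<bar> \<le> 0"
        using r(3)[of y] y \<delta> by simp
      then have Ey: "E y = E x"
        using r(2) by (simp add: mult_le_0_iff)
      fix z assume "z \<in> ball y \<delta>"
      then have z: "z \<in> ball x \<delta>'" "z \<in> ball x r"
        using y(1) \<delta> dist_triangle[of x z y] by auto
      show "E y \<le> E z"
        using \<delta>'(2)[OF z(1)] Ey by simp
      have "c * (E z - E y) \<le> c * \<bar>E z - E x\<bar>"
        using r(2) Ey by (intro mult_left_mono) auto
      also have "\<dots> \<le> (norm (F z))\<^sup>2"
        by (rule r(3)[OF z(2)])
      finally show "c * (E z - E y) \<le> (norm (F z))\<^sup>2" .
    qed
    with \<delta>(1) show ?thesis by blast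
  qed
  show "lyapunov_stable F x \<longleftrightarrow> (\<forall>v. v \<bullet> F' x v \<le> 0)"
    using nsd near x(2) by (metis centre_in_ball)
  assume "lyapunov_stable F x"
  then obtain \<delta> where \<delta>: "0 < \<delta>" "\<forall>y\<in>ball x \<delta>. F y = 0 \<longrightarrow> lyapunov_stable F y"
    using nsd near by blast
  have "submanifold d (ball x \<delta> \<inter> (U \<inter> equilibria F))"
    by (rule submanifold_open_Int[OF M open_ball])
  then show "\<exists>M. submanifold d M \<and> x \<in> M \<and> (\<forall>y\<in>M. y \<in> equilibria F \<and> lyapunov_stable F y)"
    using \<delta> x by (intro exI[of _ "ball x \<delta> \<inter> (U \<inter> equilibria F)"]) (auto simp: equilibria_def)
qed

end

section \<open>Coupled systems on graphs\<close>

text \<open>At each point the local power series supplies the derivative, and the series of the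
  derivative supplies its continuity at that point.\<close>

lemma real_analytic_continuous_derivative:
  assumes "real_analytic f"
  obtains f' where "\<And>u. (f has_real_derivative f' u) (at u)" "continuous_on UNIV f'"
proof -
  have *: "(f has_real_derivative deriv f u) (at u) \<and> isCont (deriv f) u" for u
  proof -
    obtain P where P: "(\<lambda>v. f (u + v)) has_fps_expansion P"
      using assms unfolding real_analytic_def by blast
    have radius: "0 < fps_conv_radius P" and ev: "\<forall>\<^sub>F z in nhds 0. eval_fps P z = f (u + z)"
      using P by (auto simp: has_fps_expansion_def)
    have "(eval_fps P has_field_derivative eval_fps (fps_deriv P) 0) (at 0)"
      using radius by (intro has_field_derivative_eval_fps) (auto simp: zero_ereal_def)
    then have "((\<lambda>v. f (u + v)) has_field_derivative eval_fps (fps_deriv P) 0) (at 0)"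
      using DERIV_cong_ev[OF refl ev refl] by blast
    then have "(f has_field_derivative eval_fps (fps_deriv P) 0) (at u)"
      using DERIV_shift[of f _ 0 u] by (simp add: add.commute)
    moreover have "isCont (deriv (\<lambda>v. f (u + v))) 0"
      using has_fps_expansion_imp_continuous[OF has_fps_expansion_deriv[OF P], of UNIV] by simp
    moreover have "deriv (\<lambda>v. f (u + v)) = (\<lambda>v. deriv f (u + v))"
      by (simp add: deriv_def DERIV_shift fun_eq_iff add.commute[of u])
    ultimately show ?thesis
      using isCont_o2[of u "\<lambda>w. w - u" "\<lambda>v. deriv f (u + v)"] by (auto simp: DERIV_imp_deriv)
  qed
  then show thesis
    using that[of "deriv f"] by (simp add: continuous_at_imp_continuous_on)
qed

section \<open>The coupled system as a gradient system\<close>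

lemma odd_function_derivative_even:
  assumes "odd_function f" and f': "\<And>u. (f has_real_derivative f' u) (at u)"
  shows "f' (- u) = f' u"
proof -
  have "((\<lambda>u. f (- u)) has_real_derivative - f' (- u)) (at u)"
    using DERIV_chain2[where f = f and g = uminus, OF f' DERIV_minus[OF DERIV_ident]] by simp
  moreover have "((\<lambda>u. f (- u)) has_real_derivative - f' u) (at u)"
    using assms(1) DERIV_minus[OF f'] unfolding odd_function_def by simp
  ultimately show ?thesis
    using DERIV_unique by fastforce
qed

text \<open>Each undirected edge gives two ordered adjacent pairs, one in \<open>E\<close> and one
  in its reversal. This links the field, summed over neighbors, to the energy, summed over oriented
  edges.\<close>

lemma sum_neighbors_orientation:
  fixes T :: "'n::finite \<Rightarrow> 'n \<Rightarrow> 'b::comm_monoid_add"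
  assumes "simple_graph adj" and E: "orientation adj E"
  shows "(\<Sum>i\<in>UNIV. \<Sum>j | adj i j. T i j) = (\<Sum>(j, k)\<in>E. T j k + T k j)"
proof -
  have sym: "adj i j \<Longrightarrow> adj j i" for i j
    using assms(1) by (auto simp: simple_graph_def dest: sympD)
  have sub: "adj i j" if "(i, j) \<in> E" for i j
    using E that unfolding orientation_def by blast
  have one: "((i, j) \<in> E) \<noteq> ((j, i) \<in> E)" if "adj i j" for i j
    using E that unfolding orientation_def by blast
  have swap: "(i, j) \<in> prod.swap ` E \<longleftrightarrow> (j, i) \<in> E" for i j
    by force
  have edges: "Sigma UNIV (\<lambda>i. {j. adj i j}) = E \<union> prod.swap ` E"
  proof (rule set_eqI)
    fix p :: "'n \<times> 'n"
    obtain i j where p: "p = (i, j)" by fastforce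
    show "p \<in> Sigma UNIV (\<lambda>i. {j. adj i j}) \<longleftrightarrow> p \<in> E \<union> prod.swap ` E"
      unfolding p using sub[of i j] sub[of j i] sym[of j i] one[of i j]
      by (simp only: Un_iff swap mem_Sigma_iff) auto
  qed
  have disjoint: "E \<inter> prod.swap ` E = {}"
  proof (rule Int_emptyI)
    fix p assume *: "p \<in> E" "p \<in> prod.swap ` E"
    obtain i j where p: "p = (i, j)" by fastforce
    show False
      using sub[of i j] one[of i j] swap[of i j] * unfolding p by simp
  qed
  have "(\<Sum>i\<in>UNIV. \<Sum>j | adj i j. T i j) = (\<Sum>(i, j)\<in>E \<union> prod.swap ` E. T i j)"
    by (simp add: sum.Sigma flip: edges)
  also have "\<dots> = (\<Sum>(i, j)\<in>E. T i j) + (\<Sum>(i, j)\<in>prod.swap ` E. T i j)"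
    using disjoint by (intro sum.union_disjoint) auto
  also have "(\<Sum>(i, j)\<in>prod.swap ` E. T i j) = (\<Sum>(j, k)\<in>E. T k j)"
    by (subst sum.reindex) (auto simp: o_def split_def)
  finally show ?thesis
    by (simp add: sum.distrib split_def)
qed

text \<open>With \<open>f'\<close> the derivative of \<open>f\<close>, this is the Jacobian of
  \<open>coupled_field adj f\<close> at \<open>y\<close>: minus a weighted graph Laplacian.\<close>

definition coupled_derivative ::
  "('n::finite \<Rightarrow> 'n \<Rightarrow> bool) \<Rightarrow> (real \<Rightarrow> real) \<Rightarrow> real^'n \<Rightarrow> real^'n \<Rightarrow> real^'n" where
  "coupled_derivative adj f' y v = (\<chi> i. \<Sum>j | adj i j. f' (y $ j - y $ i) * (v $ j - v $ i))"

text \<open>Oddness of \<open>f\<close> merges the two terms of each edge into minus the derivative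
  of its energy; evenness of \<open>f'\<close> makes the Jacobian symmetric.\<close>

lemma gradient_system_coupled:
  fixes adj :: "'n::finite \<Rightarrow> 'n \<Rightarrow> bool"
  assumes graph: "simple_graph adj" and orient: "orientation adj E" and odd: "odd_function f"
    and f': "\<And>u. (f has_real_derivative f' u) (at u)" "continuous_on UNIV f'"
    and g: "\<And>u. (g has_real_derivative f u) (at u)"
  shows "gradient_system (energy E g) (coupled_field adj f) (coupled_derivative adj f')"
proof
  fix y u v :: "real^'n"
  have diff: "((\<lambda>x. x $ k - x $ j) has_derivative (\<lambda>h. h $ k - h $ j)) (at y)" for j k :: 'n
    by (intro has_derivative_diff bounded_linear_imp_has_derivative bounded_linear_vec_nth)
  have chain: "((\<lambda>x. h (x $ k - x $ j)) has_derivative (\<lambda>v. h' (y $ k - y $ j) * (v $ k - v $ j))) (at y)"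
    if "\<And>u. (h has_real_derivative h' u) (at u)" for h h' and j k :: 'n
    using has_derivative_compose[OF diff that[unfolded has_field_derivative_def]] .
  have "((\<lambda>x. \<Sum>(j, k)\<in>E. g (x $ k - x $ j)) has_derivative
      (\<lambda>h. \<Sum>(j, k)\<in>E. f (y $ k - y $ j) * (h $ k - h $ j))) (at y)"
    unfolding split_def by (intro has_derivative_sum chain g)
  moreover have "(\<Sum>(j, k)\<in>E. f (y $ k - y $ j) * (h $ k - h $ j)) = - (coupled_field adj f y \<bullet> h)" for h
  proof -
    have edge: "f (y $ k - y $ j) * h $ j + f (y $ j - y $ k) * h $ k = - (f (y $ k - y $ j) * (h $ k - h $ j))" for j k
    proof -
      have "f (y $ j - y $ k) = - f (y $ k - y $ j)"
        using odd unfolding odd_function_def by (metis minus_diff_eq)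
      then show ?thesis
        by (simp add: algebra_simps)
    qed
    have "coupled_field adj f y \<bullet> h = (\<Sum>i\<in>UNIV. \<Sum>j | adj i j. f (y $ j - y $ i) * h $ i)"
      by (simp add: inner_vec_def coupled_field_def sum_distrib_right)
    also have "\<dots> = (\<Sum>(j, k)\<in>E. f (y $ k - y $ j) * h $ j + f (y $ j - y $ k) * h $ k)"
      by (rule sum_neighbors_orientation[OF graph orient])
    also have "\<dots> = (\<Sum>(j, k)\<in>E. - (f (y $ k - y $ j) * (h $ k - h $ j)))"
      by (simp only: edge)
    finally show ?thesis
      by (simp add: sum_negf split_def)
  qed
  ultimately show "(energy E g has_derivative (\<lambda>h. - (coupled_field adj f y \<bullet> h))) (at y)"
    by (simp add: energy_def[abs_def])
  show "(coupled_field adj f has_derivative coupled_derivative adj f' y) (at y)"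
    unfolding has_derivative_componentwise_within[of "coupled_field adj f"]
    by (auto simp: Basis_vec_def inner_axis coupled_field_def coupled_derivative_def
        intro!: has_derivative_sum chain f'(1))
  show "continuous_on UNIV (\<lambda>y. coupled_derivative adj f' y v)"
    unfolding coupled_derivative_def
    by (intro continuous_on_vec_lambda continuous_intros continuous_on_compose2[OF f'(2)]) auto
  \<comment> \<open>Summation by parts over the edges; the right side is visibly symmetric in
    \<open>u\<close> and \<open>v\<close>.\<close>
  have form: "coupled_derivative adj f' y u \<bullet> v =
      (\<Sum>(j, k)\<in>E. - f' (y $ k - y $ j) * (u $ k - u $ j) * (v $ k - v $ j))" for u v
  proof -
    have edge: "f' (y $ k - y $ j) * (u $ k - u $ j) * v $ j + f' (y $ j - y $ k) * (u $ j - u $ k) * v $ k =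
        - f' (y $ k - y $ j) * (u $ k - u $ j) * (v $ k - v $ j)" for j k
    proof -
      have "f' (y $ j - y $ k) = f' (y $ k - y $ j)"
        using odd_function_derivative_even[OF odd f'(1), of "y $ k - y $ j"] by simp
      then show ?thesis
        by (simp add: algebra_simps)
    qed
    have "coupled_derivative adj f' y u \<bullet> v =
        (\<Sum>i\<in>UNIV. \<Sum>j | adj i j. f' (y $ j - y $ i) * (u $ j - u $ i) * v $ i)"
      by (simp add: inner_vec_def coupled_derivative_def sum_distrib_right)
    also have "\<dots> = (\<Sum>(j, k)\<in>E. f' (y $ k - y $ j) * (u $ k - u $ j) * v $ j +
        f' (y $ j - y $ k) * (u $ j - u $ k) * v $ k)"
      by (rule sum_neighbors_orientation[OF graph orient])
    also have "\<dots> = (\<Sum>(j, k)\<in>E. - f' (y $ k - y $ j) * (u $ k - u $ j) * (v $ k - v $ j))"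
      by (simp only: edge)
    finally show ?thesis .
  qed
  show "coupled_derivative adj f' y u \<bullet> v = u \<bullet> coupled_derivative adj f' y v"
    unfolding inner_commute[of u] form by (simp add: mult_ac)
qed

section \<open>The Hessian matrix and its kernel\<close>

lemma gradient_system_hessian:
  fixes F :: "real^'n::finite \<Rightarrow> real^'n"
  assumes "gradient_system E F F'"
  shows "hessian E y *v v = - F' y v" and "transpose (hessian E y) = hessian E y"
proof -
  interpret gradient_system E F F' by fact
  have line: "((\<lambda>t::real. z + t *\<^sub>R axis i 1) has_derivative (\<lambda>t. t *\<^sub>R axis i 1)) (at 0)"
    for z :: "real^'n" and i
    by (auto intro!: derivative_eq_intros)
  have partial: "partial_derivative j h z = D (axis j 1)"
    if "(h has_derivative D) (at z)" for h :: "real^'n \<Rightarrow> real" and D j z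
  proof -
    have "(h has_derivative D) (at (z + 0 *\<^sub>R axis j 1))"
      using that by simp
    from has_derivative_compose[OF line this]
    have "((\<lambda>t. h (z + t *\<^sub>R axis j 1)) has_real_derivative D (axis j 1)) (at 0)"
      by (rule has_derivative_imp_has_field_derivative)
        (simp add: linear_cmul[OF has_derivative_linear[OF that]])
    then show ?thesis
      unfolding partial_derivative_def by (rule DERIV_imp_deriv)
  qed
  \<comment> \<open>The first partials are known at every point as components of \<open>- F\<close>,
    so the second partials come from the derivative of \<open>F\<close>.\<close>
  have grad: "partial_derivative j E = (\<lambda>z. - (F z \<bullet> axis j 1))" for j
    using partial[OF E_deriv] by blast
  have "((\<lambda>z. - (F z \<bullet> axis j 1)) has_derivative (\<lambda>h. - (F' y h \<bullet> axis j 1))) (at y)" for j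
    by (intro has_derivative_minus has_derivative_inner_left F_deriv)
  then have entry: "hessian E y $ i $ j = - (F' y (axis i 1) \<bullet> axis j 1)" for i j
    by (simp add: hessian_def grad partial[where D = "\<lambda>h. - (F' y h \<bullet> axis j 1)"])
  show "hessian E y *v v = - F' y v"
  proof (rule vec_eq_iff[THEN iffD2], rule allI)
    fix i
    have "(hessian E y *v v) $ i = - (F' y (axis i 1) \<bullet> v)"
      by (simp add: matrix_vector_mult_def entry inner_axis sum_negf) (simp add: inner_vec_def)
    \<comment> \<open>The entries carry the axis vector inside \<open>F' y\<close>; symmetry moves
      it outside, where it picks a component.\<close>
    then show "(hessian E y *v v) $ i = (- F' y v) $ i"
      by (simp add: F'_sym inner_axis')
  qed
  have "F' y (axis i 1) \<bullet> axis j 1 = F' y (axis j 1) \<bullet> axis i 1" for i j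
    by (metis F'_sym inner_commute)
  then show "transpose (hessian E y) = hessian E y"
    by (simp add: vec_eq_iff transpose_def entry)
qed

text \<open>By symmetry the kernel is the orthogonal complement of the range, and complementary
  dimensions add up.\<close>

lemma dim_kernel_symmetric_matrix:
  fixes A :: "real^'n^'n::finite"
  assumes "transpose A = A"
  shows "rank A + dim {v. A *v v = 0} = CARD('n)"
proof -
  have "{y \<in> UNIV. \<forall>x \<in> range ((*v) A). orthogonal x y} = {v. A *v v = 0}"
  proof -
    have "(A *v u) \<bullet> y = u \<bullet> (A *v y)" for u y
      by (metis assms dot_lmul_matrix transpose_matrix_vector)
    then have "(\<forall>u. orthogonal (A *v u) y) \<longleftrightarrow> A *v y = 0" for y
      by (metis inner_eq_zero_iff inner_zero_right orthogonal_def)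
    then show ?thesis by auto
  qed
  moreover have "subspace (range ((*v) A))"
    by (intro linear_subspace_image) auto
  ultimately show ?thesis
    using dim_subspace_orthogonal_to_vectors[of "range ((*v) A)" UNIV] by (simp add: rank_dim_range)
qed

section \<open>Stability of equilibria of coupled systems\<close>

theorem proposition4p7:
  fixes adj :: "'n::finite \<Rightarrow> 'n \<Rightarrow> bool"
    and E :: "('n \<times> 'n) set"
    and f g :: "real \<Rightarrow> real"
    and x :: "real^'n"
    and d :: nat
  assumes graph: "simple_graph adj"
    and orient: "orientation adj E"
    and f_odd: "odd_function f"
    and f_analytic: "real_analytic f"
    and f_nonconst: "\<not> f constant_on UNIV"
    and g_primitive: "\<And>u. (g has_real_derivative f u) (at u)"
    and x_equilibrium: "x \<in> equilibria (coupled_field adj f)"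
    and manifold: "\<exists>U. open U \<and> x \<in> U \<and> submanifold d (U \<inter> equilibria (coupled_field adj f))"
    and hessian_rank: "rank (hessian (energy E g) x) + d = CARD('n)"
  shows "(lyapunov_stable (coupled_field adj f) x \<longleftrightarrow>
            positive_semidefinite (hessian (energy E g) x)) \<and>
         (lyapunov_stable (coupled_field adj f) x \<longrightarrow>
            (\<exists>M. submanifold d M \<and> x \<in> M \<and>
               (\<forall>y\<in>M. y \<in> equilibria (coupled_field adj f) \<and>
                       lyapunov_stable (coupled_field adj f) y)))"
proof -
  obtain f' where f': "\<And>u. (f has_real_derivative f' u) (at u)" "continuous_on UNIV f'"
    using real_analytic_continuous_derivative[OF f_analytic] by blast
  have gradient: "gradient_system (energy E g) (coupled_field adj f) (coupled_derivative adj f')"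
    by (rule gradient_system_coupled[OF graph orient f_odd f' g_primitive])
  note hessian = gradient_system_hessian[OF gradient, of x]
  obtain U where U: "x \<in> U" "submanifold d (U \<inter> equilibria (coupled_field adj f))"
    using manifold by blast
  have "coupled_field adj f x = 0"
    using x_equilibrium by (simp add: equilibria_def)
  moreover have "dim {v. coupled_derivative adj f' x v = 0} = d"
    \<comment> \<open>The sign between Hessian and Jacobian does not affect the kernel, so the rank
      condition gives it dimension \<open>d\<close>.\<close>
    using dim_kernel_symmetric_matrix[OF hessian(2)] hessian_rank by (simp add: hessian(1))
  ultimately have "lyapunov_stable (coupled_field adj f) x \<longleftrightarrow>
      (\<forall>v. v \<bullet> coupled_derivative adj f' x v \<le> 0)"
    and "lyapunov_stable (coupled_field adj f) x \<Longrightarrow> \<exists>M. submanifold d M \<and> x \<in> M \<and>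
      (\<forall>y\<in>M. y \<in> equilibria (coupled_field adj f) \<and> lyapunov_stable (coupled_field adj f) y)"
    using gradient_system.lyapunov_stable_iff_negative_semidefinite[OF gradient U(1) _ U(2)] by blast+
  then show ?thesis
    using hessian by (simp add: positive_semidefinite_def)
qed

end
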